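(* Let $X$ be a set and $X'$ a locally compact Hausdorff space. Suppose that $K:X\times X'\to\mathbb{R}$ satisfies $K(x,\cdot)\in C_0(X')$ for every $x\in X$ and that $\mathrm{span}\{K(x,\cdot):x\in X\}$ is dense in $C_0(X')$; let $\mathcal{B}_K$ be the associated RKBS. Let $x_1,\dots,x_n$ be distinct points of $X$ such that $K(x_1,\cdot),\dots,K(x_n,\cdot)$ are linearly independent in $C_0(X')$, and put $\mathcal{V}:=\mathrm{span}\{K(x_j,\cdot):j=1,\dots,n\}$. Suppose that for every nonzero $g\in\mathcal{V}$ the set $\mathcal{N}(g)$ is finite. Then: (A1) for every nonzero $g\in\mathcal{V}$, $\mathcal{N}(g)$ is a finite subset of $X'$ and $$\mathrm{ext}\bigl(\partial\|\cdot\|_\infty(g)\bigr)\subset\{-K(\cdot,x'),K(\cdot,x'):x'\in\mathcal{N}(g)\};$$ (A2) for every $m\in\mathbb{N}$, all distinct $x_1',\dots,x_m'\in X'$ and every $\boldsymbol{\alpha}=[\alpha_1,\dots,\alpha_m]\in\mathbb{R}^m$, $$\Bigl\|\sum_{j=1}^m\alpha_jK(\cdot,x_j')\Bigr\|_{\mathcal{B}_K}=\|\boldsymbol{\alpha}\|_1 .$$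
   Context: $C_0(X')$ is the Banach space of continuous $f:X'\to\mathbb{R}$ such that $\{x':|f(x')|\ge\epsilon\}$ is compact for all $\epsilon>0$, with the norm $\|f\|_\infty=\sup_{x'\in X'}|f(x')|$. $\mathfrak{M}(X')$ is the space of real-valued regular Borel measures on $X'$ with total variation norm $\|\cdot\|_{\mathrm{TV}}$ (the dual of $C_0(X')$). The space $\mathcal{B}_K$ of functions on $X$ is $$\mathcal{B}_K:=\Bigl\{f_\mu:=\int_{X'}K(\cdot,x')\,d\mu(x'):\mu\in\mathfrak{M}(X')\Bigr\},\qquad\|f_\mu\|_{\mathcal{B}_K}:=\|\mu\|_{\mathrm{TV}}.$$ By the density condition $\mu\mapsto f_\mu$ is an isometric isomorphism of $\mathfrak{M}(X')$ onto $\mathcal{B}_K$, and through it $\mathcal{B}_K$ is identified with the dual of $C_0(X')$: $\langle g,f_\mu\rangle_{\mathcal{B}_K}=\int_{X'}g\,d\mu$. Accordingly the subdifferential $\partial\|\cdot\|_\infty(g)$ of the norm of $C_0(X')$ at $g$ is a subset of $\mathcal{B}_K$. For $g\in C_0(X')$, $\mathcal{N}(g):=\{x'\in X':|g(x')|=\|g\|_\infty\}$. $\mathrm{ext}$ denotes the set of extreme points. *)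

theory Defs
  imports "HOL-Analysis.Analysis" "HOL-Library.Function_Algebras"
begin

text \<open>
  Real-valued functions form a real vector space pointwise, so that \<^const>\<open>span\<close>, \<^const>\<open>dependent\<close>
  and \<^const>\<open>extreme_point_of\<close> apply to sets of functions.
\<close>

instantiation "fun" :: (type, real_vector) real_vector
begin

definition scaleR_fun_def: "r *\<^sub>R f = (\<lambda>x. r *\<^sub>R f x)"

instance
  by standard (simp_all add: scaleR_fun_def fun_eq_iff scaleR_add_right scaleR_add_left)

end

lemma scaleR_fun_apply [simp]: "(r *\<^sub>R f) x = r *\<^sub>R f x"
  by (simp add: scaleR_fun_def)


definition C0 :: "('b::topological_space \<Rightarrow> real) set" where
  "C0 = {f. continuous_on UNIV f \<and> (\<forall>\<epsilon>>0. compact {x'. \<epsilon> \<le> \<bar>f x'\<bar>})}"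

definition sup_norm :: "('b \<Rightarrow> real) \<Rightarrow> real" where
  "sup_norm f = (SUP x'. \<bar>f x'\<bar>)"

definition norming_set :: "('b \<Rightarrow> real) \<Rightarrow> 'b set" where
  "norming_set g = {x'. \<bar>g x'\<bar> = sup_norm g}"


text \<open>
  A real-valued Borel measure is a countably additive real set function on the Borel sets. It is
  normalised to vanish on non-Borel sets, so that equality of set functions is equality of measures.
\<close>

definition signed_borel_measure :: "('b::topological_space set \<Rightarrow> real) \<Rightarrow> bool" where
  "signed_borel_measure \<mu> \<longleftrightarrow>
     (\<forall>A::nat \<Rightarrow> 'b set. range A \<subseteq> sets borel \<longrightarrow> disjoint_family A \<longrightarrow>
        (\<lambda>i. \<mu> (A i)) sums \<mu> (\<Union>i. A i)) \<and>
     (\<forall>A. A \<notin> sets borel \<longrightarrow> \<mu> A = 0)"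

definition variation :: "('b::topological_space set \<Rightarrow> real) \<Rightarrow> 'b set \<Rightarrow> ennreal" where
  "variation \<mu> A =
     (SUP P \<in> {P. finite P \<and> P \<subseteq> sets borel \<and> partition_on A P}. \<Sum>B\<in>P. ennreal \<bar>\<mu> B\<bar>)"

definition regular_signed_measure :: "('b::topological_space set \<Rightarrow> real) \<Rightarrow> bool" where
  "regular_signed_measure \<mu> \<longleftrightarrow>
     (\<forall>A\<in>sets borel.
        variation \<mu> A = (INF U \<in> {U. open U \<and> A \<subseteq> U}. variation \<mu> U) \<and>
        variation \<mu> A = (SUP C \<in> {C. compact C \<and> C \<subseteq> A}. variation \<mu> C))"

definition regular_measures :: "('b::topological_space set \<Rightarrow> real) set" where
  "regular_measures = {\<mu>. signed_borel_measure \<mu> \<and> regular_signed_measure \<mu>}"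

definition tv_norm :: "('b::topological_space set \<Rightarrow> real) \<Rightarrow> real" where
  "tv_norm \<mu> = enn2real (variation \<mu> UNIV)"

text \<open>
  The Jordan decomposition, with positive part \<open>(\<bar>\<mu>\<bar> + \<mu>) / 2\<close> and negative part \<open>(\<bar>\<mu>\<bar> - \<mu>) / 2\<close>.
  The variation of a real-valued measure is finite, so \<^const>\<open>enn2real\<close> loses nothing.
\<close>

definition pos_part :: "('b::topological_space set \<Rightarrow> real) \<Rightarrow> 'b measure" where
  "pos_part \<mu> = measure_of UNIV (sets borel) (\<lambda>A. ennreal ((enn2real (variation \<mu> A) + \<mu> A) / 2))"

definition neg_part :: "('b::topological_space set \<Rightarrow> real) \<Rightarrow> 'b measure" where
  "neg_part \<mu> = measure_of UNIV (sets borel) (\<lambda>A. ennreal ((enn2real (variation \<mu> A) - \<mu> A) / 2))"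

definition signed_integral :: "('b::topological_space set \<Rightarrow> real) \<Rightarrow> ('b \<Rightarrow> real) \<Rightarrow> real" where
  "signed_integral \<mu> g = integral\<^sup>L (pos_part \<mu>) g - integral\<^sup>L (neg_part \<mu>) g"


text \<open>
  The space \<open>\<B>\<^sub>K\<close> consists of the functions \<open>f\<^sub>\<mu>\<close>. When the functions \<open>K x\<close> span a dense subspace of
  \<^const>\<open>C0\<close> over a locally compact Hausdorff space, the representing measure of an element of
  \<open>\<B>\<^sub>K\<close> is unique; the norm and the pairing with \<^const>\<open>C0\<close> are read off from it.
\<close>

definition rkbs_fun :: "('a \<Rightarrow> 'b::topological_space \<Rightarrow> real) \<Rightarrow> ('b set \<Rightarrow> real) \<Rightarrow> 'a \<Rightarrow> real" where
  "rkbs_fun K \<mu> = (\<lambda>x. signed_integral \<mu> (K x))"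

definition rkbs :: "('a \<Rightarrow> 'b::topological_space \<Rightarrow> real) \<Rightarrow> ('a \<Rightarrow> real) set" where
  "rkbs K = rkbs_fun K ` regular_measures"

definition rkbs_measure :: "('a \<Rightarrow> 'b::topological_space \<Rightarrow> real) \<Rightarrow> ('a \<Rightarrow> real) \<Rightarrow> 'b set \<Rightarrow> real" where
  "rkbs_measure K f = (THE \<mu>. \<mu> \<in> regular_measures \<and> rkbs_fun K \<mu> = f)"

definition rkbs_norm :: "('a \<Rightarrow> 'b::topological_space \<Rightarrow> real) \<Rightarrow> ('a \<Rightarrow> real) \<Rightarrow> real" where
  "rkbs_norm K f = tv_norm (rkbs_measure K f)"

definition rkbs_pairing :: "('a \<Rightarrow> 'b::topological_space \<Rightarrow> real) \<Rightarrow> ('b \<Rightarrow> real) \<Rightarrow> ('a \<Rightarrow> real) \<Rightarrow> real" where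
  "rkbs_pairing K g f = signed_integral (rkbs_measure K f) g"

definition sup_norm_subdiff :: "('a \<Rightarrow> 'b::topological_space \<Rightarrow> real) \<Rightarrow> ('b \<Rightarrow> real) \<Rightarrow> ('a \<Rightarrow> real) set" where
  "sup_norm_subdiff K g =
     {f \<in> rkbs K. \<forall>h\<in>C0. sup_norm h - sup_norm g \<ge> rkbs_pairing K (h - g) f}"

end

theory Submission
  imports Defs
begin

text \<open>
  The theorem describes the dual unit ball of \<^const>\<open>C0\<close> by point masses. The map from a regular
  measure \<open>\<mu>\<close> to \<open>f\<^sub>\<mu>\<close> is injective: \<open>f\<^sub>\<mu>\<close> lists the integrals of the functions \<open>K y\<close>, these
  determine all integrals over \<^const>\<open>C0\<close> by density, and a regular measure is determined by its
  integrals (\<open>rkbs_measure_eq\<close>). So the norm and the pairing of \<open>f\<^sub>\<mu>\<close> may be computed from any regular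
  measure that represents it. The function \<open>\<Sum>\<^sub>j \<alpha>\<^sub>j K(\<cdot>, x\<^sub>j)\<close> is represented by the combination of
  point masses with weights \<open>\<alpha>\<^sub>j\<close>, whose total variation is \<open>\<Sum>\<^sub>j \<bar>\<alpha>\<^sub>j\<bar>\<close> because the points are
  distinct. This is the second claim.

  For the first claim, let \<open>f\<^sub>\<mu>\<close> be a subgradient of the sup norm at \<open>g \<noteq> 0\<close>. Then \<open>\<mu>\<close> has total
  variation at most 1 and its integral against \<open>g\<close> is the norm of \<open>g\<close> (\<open>sup_norm_subdiffD\<close>). This is
  possible only if \<open>\<mu>\<close> puts all its mass on the norming set of \<open>g\<close>, with the sign of \<open>g\<close> at each
  point (\<open>norming_measure_concentrated\<close>). The norming set being finite, \<open>f\<^sub>\<mu>\<close> is a convex combination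
  of the functions \<open>sgn (g p) K(\<cdot>, p)\<close> with \<open>p\<close> norming. Conversely all such combinations are
  subgradients, so the subdifferential is the convex hull of these finitely many functions, and its
  extreme points are among them.

  The measure theory behind this is elementary: the Jordan parts are obtained by proving that the
  variation is a finite measure, without a Hahn decomposition, and the part of the Riesz
  representation theorem that is used, namely that \<^const>\<open>C0\<close> separates regular measures and norms them,
  follows from regularity and Urysohn's lemma.
\<close>

section \<open>Signed Borel measures and their variation\<close>

lemma signed_borel_measure_sums:
  assumes "signed_borel_measure \<mu>" "range A \<subseteq> sets borel" "disjoint_family A"
  shows "(\<lambda>i. \<mu> (A i)) sums \<mu> (\<Union>i. A i)"
  using assms by (auto simp: signed_borel_measure_def)

lemma signed_borel_measure_empty:
  assumes "signed_borel_measure \<mu>"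
  shows "\<mu> {} = 0"
proof -
  have "(\<lambda>i::nat. \<mu> {}) sums \<mu> {}"
    using signed_borel_measure_sums[OF assms, of "\<lambda>_. {}"] by (simp add: disjoint_family_on_def)
  from sums_summable[OF this] show ?thesis
    by (simp add: summable_const_iff)
qed

lemma signed_borel_measure_Un:
  assumes \<mu>: "signed_borel_measure \<mu>"
    and A: "A \<in> sets borel" and B: "B \<in> sets borel" and disj: "A \<inter> B = {}"
  shows "\<mu> (A \<union> B) = \<mu> A + \<mu> B"
proof -
  have "(\<lambda>i. \<mu> (binaryset A B i)) sums \<mu> (\<Union>i. binaryset A B i)"
    using A B disj
    by (intro signed_borel_measure_sums[OF \<mu>])
       (auto simp: range_binaryset_eq disjoint_family_on_def binaryset_def)
  moreover have "(\<lambda>i. \<mu> (binaryset A B i)) sums (\<mu> A + \<mu> B)"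
    using signed_borel_measure_empty[OF \<mu>] by (rule binaryset_sums)
  ultimately show ?thesis
    by (simp add: UN_binaryset_eq sums_unique2)
qed

lemma signed_borel_measure_Diff:
  assumes "signed_borel_measure \<mu>" "A \<in> sets borel" "B \<in> sets borel" "B \<subseteq> A"
  shows "\<mu> (A - B) = \<mu> A - \<mu> B"
  using signed_borel_measure_Un[OF assms(1), of "A - B" B] assms by (simp add: Un_absorb2 Int_commute)

lemma signed_borel_measure_Union:
  assumes \<mu>: "signed_borel_measure \<mu>"
    and "finite P" "P \<subseteq> sets borel" "disjoint P"
  shows "\<mu> (\<Union>P) = (\<Sum>B\<in>P. \<mu> B)"
  using assms(2-4)
proof (induction P rule: finite_induct)
  case empty
  then show ?case using signed_borel_measure_empty[OF \<mu>] by simp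
next
  case (insert B P)
  have "B \<inter> \<Union>P = {}" using insert by (auto simp: pairwise_insert disjnt_def)
  moreover have "\<Union>P \<in> sets borel" using insert by (intro sets.finite_Union) auto
  ultimately have "\<mu> (B \<union> \<Union>P) = \<mu> B + \<mu> (\<Union>P)"
    using insert by (intro signed_borel_measure_Un[OF \<mu>]) auto
  then show ?case using insert by (simp add: pairwise_insert)
qed

lemma signed_borel_measure_uminus:
  assumes "signed_borel_measure \<mu>"
  shows "signed_borel_measure (\<lambda>A. - \<mu> A)"
  using assms unfolding signed_borel_measure_def by (auto intro: sums_minus)

lemma variation_uminus: "variation (\<lambda>A. - \<mu> A) = variation \<mu>"
  by (simp add: variation_def fun_eq_iff)

lemma sum_le_variation:
  assumes "finite P" "P \<subseteq> sets borel" "partition_on A P"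
  shows "(\<Sum>B\<in>P. ennreal \<bar>\<mu> B\<bar>) \<le> variation \<mu> A"
  unfolding variation_def using assms by (intro SUP_upper) auto

text \<open>
  Collecting the cells of a partition on which the measure is nonnegative shows that splittings into
  two sets already exhaust the variation.
\<close>

lemma partition_split:
  assumes \<mu>: "signed_borel_measure \<mu>"
    and P: "finite P" "P \<subseteq> sets borel" "partition_on A P"
  obtains D where "D \<in> sets borel" "D \<subseteq> A" "(\<Sum>B\<in>P. ennreal \<bar>\<mu> B\<bar>) = ennreal (\<mu> D - \<mu> (A - D))"
proof
  let ?P = "{B \<in> P. 0 \<le> \<mu> B}" and ?N = "{B \<in> P. \<mu> B < 0}"
  have disj: "disjoint P" and A: "\<Union>P = A" using P by (auto simp: partition_on_def)
  show "\<Union>?P \<in> sets borel" using P by (intro sets.finite_Union) auto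
  show "\<Union>?P \<subseteq> A" using A by auto
  have "A - \<Union>?P = \<Union>?N"
  proof -
    have "B = C" if "B \<in> P" "C \<in> P" "y \<in> B" "y \<in> C" for B C y
      using disj that by (meson disjnt_iff pairwiseD)
    then show ?thesis using A by (auto simp: not_le) (metis not_le)+
  qed
  moreover have "\<mu> (\<Union>?P) = sum \<mu> ?P" "\<mu> (\<Union>?N) = sum \<mu> ?N"
    using P disj by (auto intro!: signed_borel_measure_Union[OF \<mu>] intro: pairwise_subset)
  moreover have "(\<Sum>B\<in>P. \<bar>\<mu> B\<bar>) = (\<Sum>B\<in>?P. \<bar>\<mu> B\<bar>) + (\<Sum>B\<in>?N. \<bar>\<mu> B\<bar>)"
    using P by (subst sum.union_disjoint[symmetric]) (auto intro!: sum.cong)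
  moreover have "(\<Sum>B\<in>?P. \<bar>\<mu> B\<bar>) = sum \<mu> ?P" "(\<Sum>B\<in>?N. \<bar>\<mu> B\<bar>) = - sum \<mu> ?N"
    by (auto simp: sum_negf[symmetric] intro!: sum.cong)
  ultimately show "(\<Sum>B\<in>P. ennreal \<bar>\<mu> B\<bar>) = ennreal (\<mu> (\<Union>?P) - \<mu> (A - \<Union>?P))"
    by (simp add: sum_ennreal)
qed

lemma split_le_variation:
  assumes \<mu>: "signed_borel_measure \<mu>"
    and "A \<in> sets borel" "D \<in> sets borel" "D \<subseteq> A"
  shows "ennreal (\<bar>\<mu> D\<bar> + \<bar>\<mu> (A - D)\<bar>) \<le> variation \<mu> A"
proof -
  let ?P = "{D, A - D} - {{}}"
  have "(\<Sum>B\<in>?P. ennreal \<bar>\<mu> B\<bar>) \<le> variation \<mu> A"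
    using assms by (intro sum_le_variation) (auto simp: partition_on_def pairwise_def disjnt_def)
  moreover have "(\<Sum>B\<in>?P. ennreal \<bar>\<mu> B\<bar>) = ennreal (\<bar>\<mu> D\<bar> + \<bar>\<mu> (A - D)\<bar>)"
  proof (cases "D = {} \<or> A - D = {}")
    case True
    then show ?thesis
      using signed_borel_measure_empty[OF \<mu>] assms(4) by (cases "A = {}") (auto simp: insert_Diff_if)
  next
    case False
    then have "?P = {D, A - D}" "D \<noteq> A - D" by auto
    then show ?thesis by (simp only: sum.insert sum.empty finite.intros empty_iff insert_iff) simp
  qed
  ultimately show ?thesis by simp
qed

text \<open>
  A partition of \<open>A\<close> and one of \<open>B\<close> together form a partition of the union, so the bound follows from
  the definition of the variation without any additivity of \<open>\<mu>\<close>.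
\<close>

lemma variation_superadditive:
  assumes A: "A \<in> sets borel" and B: "B \<in> sets borel" and disj: "A \<inter> B = {}"
  shows "variation \<mu> A + variation \<mu> B \<le> variation \<mu> (A \<union> B)"
proof -
  let ?Q = "\<lambda>A. {P. finite P \<and> P \<subseteq> sets borel \<and> partition_on A P}"
  let ?s = "\<lambda>P. \<Sum>B\<in>P. ennreal \<bar>\<mu> B\<bar>"
  have ne: "?Q A \<noteq> {}" if "A \<in> sets borel" for A :: "'a set"
  proof -
    have "{A} - {{}} \<in> ?Q A" using that by (auto simp: partition_on_def pairwise_def)
    then show ?thesis by blast
  qed
  have le: "?s P + ?s Q \<le> variation \<mu> (A \<union> B)" if P: "P \<in> ?Q A" and Q: "Q \<in> ?Q B" for P Q
  proof -
    have "C \<noteq> {} \<and> C \<subseteq> A" if "C \<in> P" for C using P that by (auto simp: partition_on_def)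
    moreover have "C \<subseteq> B" if "C \<in> Q" for C using Q that by (auto simp: partition_on_def)
    ultimately have "P \<inter> Q = {}" using disj by blast
    moreover have "partition_on (A \<union> B) (P \<union> Q)"
    proof (rule partition_onI)
      show "\<Union>(P \<union> Q) = A \<union> B" "{} \<notin> P \<union> Q"
        using P Q by (auto simp: partition_on_def)
      have "C \<subseteq> A" if "C \<in> P" for C using P that by (auto simp: partition_on_def)
      moreover have "C \<subseteq> B" if "C \<in> Q" for C using Q that by (auto simp: partition_on_def)
      ultimately have "disjnt C D" if "C \<in> P" "D \<in> Q" for C D
        using disj that by (fastforce simp: disjnt_def)
      moreover have "disjoint P" "disjoint Q" using P Q by (auto simp: partition_on_def)
      ultimately show "disjnt C D" if "C \<in> P \<union> Q" "D \<in> P \<union> Q" "C \<noteq> D" for C D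
        using that by (metis Un_iff disjnt_sym pairwiseD)
    qed
    ultimately show ?thesis
      using sum_le_variation[of "P \<union> Q" "A \<union> B" \<mu>] P Q by (simp add: sum.union_disjoint)
  qed
  have "variation \<mu> A + variation \<mu> B = (SUP P\<in>?Q A. ?s P + variation \<mu> B)"
    unfolding variation_def[of _ A] by (rule ennreal_SUP_add_left[OF ne[OF A], symmetric])
  also have "\<dots> = (SUP P\<in>?Q A. SUP Q\<in>?Q B. ?s P + ?s Q)"
    unfolding variation_def[of _ B]
    by (intro SUP_cong refl ennreal_SUP_add_right[OF ne[OF B]])
  also have "\<dots> \<le> variation \<mu> (A \<union> B)"
    by (intro SUP_least le)
  finally show ?thesis .
qed

lemma variation_mono:
  assumes "A \<in> sets borel" "B \<in> sets borel" "A \<subseteq> B"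
  shows "variation \<mu> A \<le> variation \<mu> B"
proof -
  have "variation \<mu> A \<le> variation \<mu> A + variation \<mu> (B - A)" by simp
  also have "\<dots> \<le> variation \<mu> (A \<union> (B - A))"
    using assms by (intro variation_superadditive) auto
  finally show ?thesis using assms(3) by (simp add: Un_absorb1)
qed

lemma ennreal_sum_le: "ennreal (\<Sum>i\<in>I. f i) \<le> (\<Sum>i\<in>I. ennreal (f i))"
proof (induction I rule: infinite_finite_induct)
  case (insert i I)
  have "ennreal (f i + sum f I) \<le> ennreal (f i) + ennreal (sum f I)"
    by (simp add: ennreal_plus_if ennreal_leI)
  also have "\<dots> \<le> ennreal (f i) + (\<Sum>i\<in>I. ennreal (f i))"
    using insert by (intro add_left_mono)
  finally show ?case using insert by simp
qed auto

text \<open>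
  One inequality is finite superadditivity. For the other, cut a two-set splitting of the union along
  the sets \<open>A i\<close>: the value of the splitting is the sum of a convergent series whose terms are values of
  splittings of the \<open>A i\<close>.
\<close>

lemma variation_UN:
  fixes A :: "nat \<Rightarrow> 'b::topological_space set"
  assumes \<mu>: "signed_borel_measure \<mu>" and A: "range A \<subseteq> sets borel" and disj: "disjoint_family A"
  shows "(\<Sum>i. variation \<mu> (A i)) = variation \<mu> (\<Union>i. A i)"
proof (rule antisym)
  have U: "(\<Union>i\<in>I. A i) \<in> sets borel" for I using A by (intro sets.countable_UN') auto
  have "(\<Sum>i<n. variation \<mu> (A i)) \<le> variation \<mu> (\<Union>i<n. A i)" for n
  proof (induction n)
    case (Suc n)
    have "A i \<inter> A n = {}" if "i < n" for i
      using disj that by (simp add: disjoint_family_on_def)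
    then have disj_n: "(\<Union>i<n. A i) \<inter> A n = {}" by blast
    have "(\<Sum>i<Suc n. variation \<mu> (A i)) \<le> variation \<mu> (\<Union>i<n. A i) + variation \<mu> (A n)"
      using Suc by (simp add: add_right_mono)
    also have "variation \<mu> (\<Union>i<n. A i) + variation \<mu> (A n) \<le> variation \<mu> ((\<Union>i<n. A i) \<union> A n)"
      using A U disj_n by (intro variation_superadditive) auto
    also have "(\<Union>i<n. A i) \<union> A n = (\<Union>i<Suc n. A i)" by (auto simp: less_Suc_eq)
    finally show ?case .
  qed simp
  moreover have "variation \<mu> (\<Union>i<n. A i) \<le> variation \<mu> (\<Union>i. A i)" for n
    using U by (intro variation_mono) auto
  ultimately have "(\<Sum>i<n. variation \<mu> (A i)) \<le> variation \<mu> (\<Union>i. A i)" for n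
    by (blast intro: order_trans)
  then show "(\<Sum>i. variation \<mu> (A i)) \<le> variation \<mu> (\<Union>i. A i)"
    by (auto simp: suminf_eq_SUP intro: SUP_least)
next
  let ?U = "\<Union>i. A i"
  have U: "?U \<in> sets borel" using A by auto
  show "variation \<mu> ?U \<le> (\<Sum>i. variation \<mu> (A i))"
    unfolding variation_def[of _ ?U]
  proof (rule SUP_least, clarify)
    fix P :: "'b set set" assume "finite P" "P \<subseteq> sets borel" "partition_on ?U P"
    then obtain D where D: "D \<in> sets borel" "D \<subseteq> ?U"
      and eq: "(\<Sum>B\<in>P. ennreal \<bar>\<mu> B\<bar>) = ennreal (\<mu> D - \<mu> (?U - D))"
      using partition_split[OF \<mu>] by blast
    let ?c = "\<lambda>i. \<mu> (D \<inter> A i) - \<mu> (A i - D)"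
    have "(\<lambda>i. \<mu> (D \<inter> A i)) sums \<mu> (\<Union>i. D \<inter> A i)"
      using A D by (intro signed_borel_measure_sums[OF \<mu>] disjoint_family_subset[OF disj]) auto
    moreover have "(\<lambda>i. \<mu> (A i - D)) sums \<mu> (\<Union>i. A i - D)"
      using A D by (intro signed_borel_measure_sums[OF \<mu>] disjoint_family_subset[OF disj]) auto
    moreover have "(\<Union>i. D \<inter> A i) = D" "(\<Union>i. A i - D) = ?U - D" using D by auto
    ultimately have "?c sums (\<mu> D - \<mu> (?U - D))" by (simp add: sums_diff)
    then have "(\<lambda>n. ennreal (\<Sum>i<n. ?c i)) \<longlonglongrightarrow> ennreal (\<mu> D - \<mu> (?U - D))"
      by (intro tendsto_ennrealI) (simp add: sums_def)
    moreover have "ennreal (\<Sum>i<n. ?c i) \<le> (\<Sum>i. variation \<mu> (A i))" for n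
    proof -
      have "ennreal (?c i) \<le> variation \<mu> (A i)" for i
      proof -
        have "ennreal (?c i) \<le> ennreal (\<bar>\<mu> (D \<inter> A i)\<bar> + \<bar>\<mu> (A i - D \<inter> A i)\<bar>)"
          by (intro ennreal_leI) (simp add: Diff_Int2[symmetric] Diff_Int)
        also have "\<dots> \<le> variation \<mu> (A i)"
          using A D by (intro split_le_variation[OF \<mu>]) auto
        finally show ?thesis .
      qed
      then have "ennreal (\<Sum>i<n. ?c i) \<le> (\<Sum>i<n. variation \<mu> (A i))"
        by (intro order_trans[OF ennreal_sum_le] sum_mono)
      also have "\<dots> \<le> (\<Sum>i. variation \<mu> (A i))" by (intro sum_le_suminf) auto
      finally show ?thesis .
    qed
    ultimately show "(\<Sum>B\<in>P. ennreal \<bar>\<mu> B\<bar>) \<le> (\<Sum>i. variation \<mu> (A i))"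
      unfolding eq by (auto intro!: LIMSEQ_le_const2 simp del: sum_ennreal)
  qed
qed

lemma variation_empty: "variation \<mu> {} = 0"
  by (simp add: variation_def partition_on_empty)

lemma variation_Un:
  assumes \<mu>: "signed_borel_measure \<mu>"
    and A: "A \<in> sets borel" and B: "B \<in> sets borel" and disj: "A \<inter> B = {}"
  shows "variation \<mu> (A \<union> B) = variation \<mu> A + variation \<mu> B"
proof -
  have "(\<Sum>i. variation \<mu> (binaryset A B i)) = variation \<mu> (\<Union>i. binaryset A B i)"
    using A B disj
    by (intro variation_UN[OF \<mu>])
       (auto simp: range_binaryset_eq disjoint_family_on_def binaryset_def)
  then show ?thesis
    by (simp add: UN_binaryset_eq suminf_binaryset_eq variation_empty)
qed

text \<open>
  If \<open>E\<close> has infinite variation, a splitting of \<open>E\<close> gives two halves both of measure larger than 1 in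
  absolute value, and one of the halves again has infinite variation. Peeling off the other half
  forever produces disjoint sets whose measures do not tend to 0.
\<close>

lemma variation_finite:
  fixes \<mu> :: "'b::topological_space set \<Rightarrow> real"
  assumes \<mu>: "signed_borel_measure \<mu>"
  shows "variation \<mu> A \<noteq> \<infinity>"
proof
  have split: "\<exists>E'. (E' \<in> sets borel \<and> variation \<mu> E' = \<infinity>) \<and> E' \<subseteq> E \<and> 1 < \<bar>\<mu> (E - E')\<bar>"
    if E: "E \<in> sets borel" "variation \<mu> E = \<infinity>" for E
  proof -
    \<comment> \<open>If \<open>\<mu> D - \<mu> (E - D)\<close> exceeds \<open>2 + 2 \<bar>\<mu> E\<bar>\<close>, then \<open>\<mu> D + \<mu> (E - D) = \<mu> E\<close> forces both terms
      to be larger than 1 in absolute value.\<close>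
    have "ennreal (2 + 2 * \<bar>\<mu> E\<bar>) < variation \<mu> E" using E by simp
    then obtain P where "finite P" "P \<subseteq> sets borel" "partition_on E P"
      and P: "ennreal (2 + 2 * \<bar>\<mu> E\<bar>) < (\<Sum>B\<in>P. ennreal \<bar>\<mu> B\<bar>)"
      unfolding variation_def less_SUP_iff by auto
    then obtain D where D: "D \<in> sets borel" "D \<subseteq> E"
      and "(\<Sum>B\<in>P. ennreal \<bar>\<mu> B\<bar>) = ennreal (\<mu> D - \<mu> (E - D))"
      using partition_split[OF \<mu>] by blast
    with P have "2 + 2 * \<bar>\<mu> E\<bar> < \<mu> D - \<mu> (E - D)"
      by (metis abs_ge_zero ennreal_less_iff add_nonneg_nonneg mult_nonneg_nonneg zero_le_numeral)
    moreover have eq: "\<mu> (E - D) = \<mu> E - \<mu> D"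
      using D E by (intro signed_borel_measure_Diff[OF \<mu>])
    ultimately have big: "1 < \<bar>\<mu> D\<bar>" "1 < \<bar>\<mu> (E - D)\<bar>" by auto
    have "variation \<mu> (D \<union> (E - D)) = variation \<mu> D + variation \<mu> (E - D)"
      using D E by (intro variation_Un[OF \<mu>]) auto
    also have "D \<union> (E - D) = E" using D by auto
    finally have "variation \<mu> D + variation \<mu> (E - D) = \<infinity>"
      using E(2) by simp
    then have "variation \<mu> D = \<infinity> \<or> variation \<mu> (E - D) = \<infinity>" by simp
    then show ?thesis
    proof
      assume "variation \<mu> D = \<infinity>"
      then show ?thesis using D big by (intro exI[of _ D]) auto
    next
      assume "variation \<mu> (E - D) = \<infinity>"
      moreover have "E - (E - D) = D" using D by auto
      ultimately show ?thesis using D E big by (intro exI[of _ "E - D"]) auto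
    qed
  qed
  assume inf: "variation \<mu> A = \<infinity>"
  have "A \<in> sets borel"
  proof (rule ccontr)
    assume A: "A \<notin> sets borel"
    have "{P. finite P \<and> P \<subseteq> sets borel \<and> partition_on A P} = {}"
      using A sets.finite_Union[of _ borel] partition_onD1 by blast
    then have "variation \<mu> A = 0" by (simp only: variation_def image_empty Sup_empty bot_ennreal)
    with inf show False by simp
  qed
  with inf have "\<exists>E::nat \<Rightarrow> _. \<forall>n. (E n \<in> sets borel \<and> variation \<mu> (E n) = \<infinity>) \<and>
      (E (Suc n) \<subseteq> E n \<and> 1 < \<bar>\<mu> (E n - E (Suc n))\<bar>)"
    using split by (intro dependent_nat_choice) auto
  then obtain E :: "nat \<Rightarrow> 'b set" where E: "\<And>n. E n \<in> sets borel"
    "\<And>n. E (Suc n) \<subseteq> E n" "\<And>n. 1 < \<bar>\<mu> (E n - E (Suc n))\<bar>" by blast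
  have "(E m - E (Suc m)) \<inter> (E n - E (Suc n)) = {}" if "m < n" for m n
    using lift_Suc_antimono_le[of E "Suc m" n] E(2) that by (auto simp: Suc_le_eq)
  then have "disjoint_family (\<lambda>n. E n - E (Suc n))"
    unfolding disjoint_family_on_def by (metis Int_commute linorder_neqE_nat)
  then have "(\<lambda>n. \<mu> (E n - E (Suc n))) sums \<mu> (\<Union>n. E n - E (Suc n))"
    using E by (intro signed_borel_measure_sums[OF \<mu>]) auto
  then have "(\<lambda>n. \<mu> (E n - E (Suc n))) \<longlonglongrightarrow> 0"
    by (intro summable_LIMSEQ_zero sums_summable)
  then obtain n where "\<bar>\<mu> (E n - E (Suc n))\<bar> < 1"
    using LIMSEQ_D[of _ 0 1] by fastforce
  with E(3)[of n] show False by simp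
qed

abbreviation tv :: "('b::topological_space set \<Rightarrow> real) \<Rightarrow> 'b set \<Rightarrow> real" where
  "tv \<mu> A \<equiv> enn2real (variation \<mu> A)"

lemma ennreal_tv:
  "signed_borel_measure \<mu> \<Longrightarrow> ennreal (tv \<mu> A) = variation \<mu> A"
  using variation_finite[of \<mu> A] by (simp add: less_top)

lemma tv_Un:
  assumes "signed_borel_measure \<mu>" "A \<in> sets borel" "B \<in> sets borel" "A \<inter> B = {}"
  shows "tv \<mu> (A \<union> B) = tv \<mu> A + tv \<mu> B"
  using variation_Un[OF assms] variation_finite[OF assms(1)]
  by (simp add: enn2real_plus less_top)

lemma tv_Diff:
  assumes "signed_borel_measure \<mu>" "A \<in> sets borel" "B \<in> sets borel" "B \<subseteq> A"
  shows "tv \<mu> (A - B) = tv \<mu> A - tv \<mu> B"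
  using tv_Un[OF assms(1), of "A - B" B] assms by (simp add: Un_absorb2 Int_commute)

lemma tv_mono:
  assumes "signed_borel_measure \<mu>" "A \<in> sets borel" "B \<in> sets borel" "A \<subseteq> B"
  shows "tv \<mu> A \<le> tv \<mu> B"
  using tv_Diff[OF assms(1,3,2,4)] enn2real_nonneg[of "variation \<mu> (B - A)"] by linarith

lemma abs_le_tv:
  assumes "signed_borel_measure \<mu>" "A \<in> sets borel"
  shows "\<bar>\<mu> A\<bar> \<le> tv \<mu> A"
proof -
  have "ennreal \<bar>\<mu> A\<bar> \<le> variation \<mu> A"
    using split_le_variation[OF assms(1,2,2)] signed_borel_measure_empty[OF assms(1)] by simp
  then show ?thesis
    using ennreal_tv[OF assms(1), of A] by (metis ennreal_le_iff enn2real_nonneg)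
qed

lemma tv_sums:
  assumes \<mu>: "signed_borel_measure \<mu>" and A: "range A \<subseteq> sets borel" "disjoint_family A"
  shows "(\<lambda>i. tv \<mu> (A i)) sums tv \<mu> (\<Union>i. A i)"
proof -
  have "(\<lambda>i. ennreal (tv \<mu> (A i))) sums ennreal (tv \<mu> (\<Union>i. A i))"
    using variation_UN[OF \<mu> A] summable_sums[of "\<lambda>i. variation \<mu> (A i)"]
    by (simp add: ennreal_tv[OF \<mu>] del: sums_ennreal)
  then show ?thesis by simp
qed

section \<open>Jordan decomposition and integration\<close>

lemma neg_part_eq_pos_part: "neg_part \<mu> = pos_part (\<lambda>A. - \<mu> A)"
  by (simp add: pos_part_def neg_part_def variation_uminus)

lemma sets_pos_part [simp, measurable_cong]: "sets (pos_part \<mu>) = sets borel"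
  by (simp add: pos_part_def sets.sigma_sets_eq[of borel, simplified])

lemma sets_neg_part [simp, measurable_cong]: "sets (neg_part \<mu>) = sets borel"
  by (simp add: neg_part_eq_pos_part)

lemma space_pos_part [simp]: "space (pos_part \<mu>) = UNIV"
  and space_neg_part [simp]: "space (neg_part \<mu>) = UNIV"
  by (simp_all add: pos_part_def neg_part_def)

lemma emeasure_pos_part:
  assumes \<mu>: "signed_borel_measure \<mu>" and A: "A \<in> sets borel"
  shows "emeasure (pos_part \<mu>) A = ennreal ((tv \<mu> A + \<mu> A) / 2)"
  unfolding pos_part_def
proof (rule emeasure_measure_of_sigma[OF _ _ _ A])
  show "sigma_algebra UNIV (sets (borel :: 'a measure))"
    using sets.sigma_algebra_axioms[of "borel :: 'a measure"] by simp
  let ?f = "\<lambda>A. (tv \<mu> A + \<mu> A) / 2"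
  show "positive (sets borel) (\<lambda>A. ennreal (?f A))"
    by (simp add: positive_def variation_empty signed_borel_measure_empty[OF \<mu>])
  show "countably_additive (sets borel) (\<lambda>A. ennreal (?f A))"
    unfolding countably_additive_def
  proof (intro allI impI)
    fix A :: "nat \<Rightarrow> 'a set"
    assume A: "range A \<subseteq> sets borel" "disjoint_family A" "(\<Union>i. A i) \<in> sets borel"
    have "(\<lambda>i. ?f (A i)) sums ?f (\<Union>i. A i)"
      by (intro sums_divide sums_add tv_sums signed_borel_measure_sums \<mu> A)
    moreover have "0 \<le> ?f B" if "B \<in> sets borel" for B
      using abs_le_tv[OF \<mu> that] by (simp add: abs_le_iff)
    then have "0 \<le> ?f (A i)" "0 \<le> ?f (\<Union>i. A i)" for i using A by blast+
    ultimately have "(\<lambda>i. ennreal (?f (A i))) sums ennreal (?f (\<Union>i. A i))"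
      by (subst sums_ennreal)
    then show "(\<Sum>i. ennreal (?f (A i))) = ennreal (?f (\<Union>i. A i))"
      by (rule sums_unique[symmetric])
  qed
qed

lemma measure_pos_part:
  assumes \<mu>: "signed_borel_measure \<mu>" and A: "A \<in> sets borel"
  shows "measure (pos_part \<mu>) A = (tv \<mu> A + \<mu> A) / 2"
  using abs_le_tv[OF \<mu> A] by (simp add: measure_def emeasure_pos_part[OF assms])

lemma measure_neg_part:
  assumes \<mu>: "signed_borel_measure \<mu>" and A: "A \<in> sets borel"
  shows "measure (neg_part \<mu>) A = (tv \<mu> A - \<mu> A) / 2"
  using measure_pos_part[OF signed_borel_measure_uminus[OF \<mu>] A]
  by (simp add: neg_part_eq_pos_part variation_uminus)

lemma finite_measure_pos_part:
  assumes "signed_borel_measure \<mu>"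
  shows "finite_measure (pos_part \<mu>)"
  by (rule finite_measureI) (simp add: emeasure_pos_part[OF assms])

lemma finite_measure_neg_part:
  "signed_borel_measure \<mu> \<Longrightarrow> finite_measure (neg_part \<mu>)"
  by (simp add: neg_part_eq_pos_part finite_measure_pos_part signed_borel_measure_uminus)

lemma integrable_parts:
  fixes f :: "_ \<Rightarrow> real"
  assumes \<mu>: "signed_borel_measure \<mu>"
    and f: "f \<in> borel_measurable borel" "\<And>x. \<bar>f x\<bar> \<le> c"
  shows "integrable (pos_part \<mu>) f" "integrable (neg_part \<mu>) f"
  using f by (auto intro!: finite_measure.integrable_const_bound[where B = c]
    finite_measure_pos_part[OF \<mu>] finite_measure_neg_part[OF \<mu>])

lemma signed_integral_add_scale:
  assumes \<mu>: "signed_borel_measure \<mu>"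
    and f: "f \<in> borel_measurable borel" "\<And>x. \<bar>f x\<bar> \<le> c"
    and g: "g \<in> borel_measurable borel" "\<And>x. \<bar>g x\<bar> \<le> d"
  shows "signed_integral \<mu> (\<lambda>x. f x + r * g x) = signed_integral \<mu> f + r * signed_integral \<mu> g"
  using integrable_parts[OF \<mu> f] integrable_parts[OF \<mu> g]
  by (simp add: signed_integral_def algebra_simps)

lemma signed_integral_bound:
  assumes \<mu>: "signed_borel_measure \<mu>"
    and f: "f \<in> borel_measurable borel" "\<And>x. \<bar>f x\<bar> \<le> c"
  shows "\<bar>signed_integral \<mu> f\<bar> \<le> c * tv \<mu> UNIV"
proof -
  interpret p: finite_measure "pos_part \<mu>" by (rule finite_measure_pos_part[OF \<mu>])
  interpret n: finite_measure "neg_part \<mu>" by (rule finite_measure_neg_part[OF \<mu>])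
  have "\<bar>integral\<^sup>L (pos_part \<mu>) f\<bar> \<le> (\<integral>x. c \<partial>pos_part \<mu>)"
    using f integrable_parts[OF \<mu> f]
    by (intro order_trans[OF integral_abs_bound] integral_mono) auto
  moreover have "\<bar>integral\<^sup>L (neg_part \<mu>) f\<bar> \<le> (\<integral>x. c \<partial>neg_part \<mu>)"
    using f integrable_parts[OF \<mu> f]
    by (intro order_trans[OF integral_abs_bound] integral_mono) auto
  ultimately have "\<bar>signed_integral \<mu> f\<bar> \<le> c * (measure (pos_part \<mu>) UNIV + measure (neg_part \<mu>) UNIV)"
    by (simp add: signed_integral_def algebra_simps)
  then show ?thesis
    by (simp add: measure_pos_part[OF \<mu>] measure_neg_part[OF \<mu>] field_simps)
qed

text \<open>
  Both Jordan parts of the integral lie between the masses of \<open>C\<close> and \<open>U\<close>, and the masses that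
  the two parts give to \<open>U - C\<close> add up to its total variation.
\<close>

lemma signed_integral_near_indicator:
  assumes \<mu>: "signed_borel_measure \<mu>"
    and h: "h \<in> borel_measurable borel" "\<And>x. indicator C x \<le> h x" "\<And>x. h x \<le> indicator U x"
    and CU: "C \<in> sets borel" "U \<in> sets borel" "C \<subseteq> U"
  shows "\<bar>signed_integral \<mu> h - \<mu> C\<bar> \<le> tv \<mu> (U - C)"
proof -
  have h_bound: "\<bar>h x\<bar> \<le> 1" for x
    using h(2,3)[of x] by (auto simp: indicator_def of_bool_def split: if_splits)
  have bounds: "measure M C \<le> integral\<^sup>L M h" "integral\<^sup>L M h \<le> measure M U"
    if M: "finite_measure M" "sets M = sets borel" "integrable M h" for M
  proof -
    interpret finite_measure M by fact
    have space: "space M = UNIV" using sets_eq_imp_space_eq[OF M(2)] by simp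
    have "integral\<^sup>L M (indicator C) \<le> integral\<^sup>L M h"
      using M CU h by (intro integral_mono integrable_real_indicator) (auto simp: less_top[symmetric])
    moreover have "integral\<^sup>L M h \<le> integral\<^sup>L M (indicator U)"
      using M CU h by (intro integral_mono integrable_real_indicator) (auto simp: less_top[symmetric])
    ultimately show "measure M C \<le> integral\<^sup>L M h" "integral\<^sup>L M h \<le> measure M U"
      by (simp_all add: space)
  qed
  note p = bounds[OF finite_measure_pos_part[OF \<mu>] sets_pos_part integrable_parts(1)[OF \<mu> h(1) h_bound]]
  note n = bounds[OF finite_measure_neg_part[OF \<mu>] sets_neg_part integrable_parts(2)[OF \<mu> h(1) h_bound]]
  show ?thesis
    using p n CU
    unfolding signed_integral_def tv_Diff[OF \<mu> CU(2,1,3)]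
    by (simp add: measure_pos_part[OF \<mu>] measure_neg_part[OF \<mu>] abs_le_iff field_simps)
qed

lemma integral_finitely_supported:
  fixes M :: "'b::t1_space measure" and g :: "'b \<Rightarrow> real"
  assumes M: "finite_measure M" "sets M = sets borel" and F: "finite F" "measure M (- F) = 0"
    and g: "g \<in> borel_measurable borel"
  shows "integral\<^sup>L M g = (\<Sum>p\<in>F. g p * measure M {p})"
proof -
  interpret finite_measure M by fact
  have space: "space M = UNIV" using sets_eq_imp_space_eq[OF M(2)] by simp
  have [measurable_cong]: "sets M = sets borel" by fact
  have closed: "closed F" using F(1) by (rule finite_imp_closed)
  have "AE x in M. x \<in> F"
  proof (rule AE_I)
    show "{x \<in> space M. x \<notin> F} \<subseteq> - F" by auto
    show "emeasure M (- F) = 0" using F(2) by (simp add: emeasure_eq_measure)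
    show "- F \<in> sets M" using closed M(2) by auto
  qed
  then have "AE x in M. g x = (\<Sum>p\<in>F. g p * indicator {p} x)"
    by eventually_elim (simp add: indicator_def F(1))
  moreover have "(\<lambda>x. \<Sum>p\<in>F. g p * indicator {p} x) \<in> borel_measurable M"
    using M(2) by (intro borel_measurable_sum borel_measurable_times borel_measurable_const
      borel_measurable_indicator) auto
  ultimately have "integral\<^sup>L M g = (\<integral>x. (\<Sum>p\<in>F. g p * indicator {p} x) \<partial>M)"
    using g M(2) by (intro integral_cong_AE) auto
  also have "\<dots> = (\<Sum>p\<in>F. g p * measure M {p})"
    using M by (subst Bochner_Integration.integral_sum) (auto simp: space less_top[symmetric])
  finally show ?thesis .
qed

lemma signed_integral_finitely_supported:
  fixes \<mu> :: "'b::t1_space set \<Rightarrow> real"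
  assumes \<mu>: "signed_borel_measure \<mu>" and F: "finite F" "tv \<mu> (- F) = 0"
    and g: "g \<in> borel_measurable borel"
  shows "signed_integral \<mu> g = (\<Sum>p\<in>F. g p * \<mu> {p})"
proof -
  have F_borel: "- F \<in> sets borel" using finite_imp_closed[OF F(1)] by auto
  then have "\<mu> (- F) = 0" using abs_le_tv[OF \<mu>, of "- F"] F(2) by simp
  then have "measure (pos_part \<mu>) (- F) = 0" "measure (neg_part \<mu>) (- F) = 0"
    using F_borel F(2) by (simp_all add: measure_pos_part[OF \<mu>] measure_neg_part[OF \<mu>])
  then have "signed_integral \<mu> g =
      (\<Sum>p\<in>F. g p * measure (pos_part \<mu>) {p}) - (\<Sum>p\<in>F. g p * measure (neg_part \<mu>) {p})"
    unfolding signed_integral_def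
    using integral_finitely_supported[OF finite_measure_pos_part[OF \<mu>] sets_pos_part F(1) _ g]
      integral_finitely_supported[OF finite_measure_neg_part[OF \<mu>] sets_neg_part F(1) _ g] by simp
  also have "\<dots> = (\<Sum>p\<in>F. g p * \<mu> {p})"
    by (simp add: sum_subtractf[symmetric] right_diff_distrib[symmetric]
      measure_pos_part[OF \<mu>] measure_neg_part[OF \<mu>] diff_divide_distrib[symmetric])
  finally show ?thesis .
qed

text \<open>
  The mass that sits where \<open>\<bar>g\<bar> < c\<close> is wasted: a measure of total variation at most 1 whose integral
  against \<open>g\<close> reaches the bound \<open>c\<close> charges only the points at which \<open>\<bar>g\<bar>\<close> equals \<open>c\<close>.
\<close>

lemma norming_measure_concentrated:
  assumes \<mu>: "signed_borel_measure \<mu>" and tv: "tv \<mu> UNIV \<le> 1"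
    and g: "g \<in> borel_measurable borel" "\<And>x. \<bar>g x\<bar> \<le> c" and attain: "c \<le> signed_integral \<mu> g"
  shows "tv \<mu> {x. \<bar>g x\<bar> \<noteq> c} = 0"
proof -
  let ?N = "{x. \<bar>g x\<bar> \<noteq> c}" and ?d = "\<lambda>x. c - \<bar>g x\<bar>"
  interpret p: finite_measure "pos_part \<mu>" by (rule finite_measure_pos_part[OF \<mu>])
  interpret n: finite_measure "neg_part \<mu>" by (rule finite_measure_neg_part[OF \<mu>])
  have c: "0 \<le> c" using g(2) abs_ge_zero order_trans by blast
  note int = integrable_parts[OF \<mu> g]
  have d: "?d \<in> borel_measurable borel" "\<And>x. \<bar>?d x\<bar> \<le> c" using g by (auto simp: abs_le_iff)
  have "integral\<^sup>L (pos_part \<mu>) g \<le> (\<integral>x. \<bar>g x\<bar> \<partial>pos_part \<mu>)"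
    using int by (intro integral_mono) auto
  moreover have "- integral\<^sup>L (neg_part \<mu>) g \<le> (\<integral>x. \<bar>g x\<bar> \<partial>neg_part \<mu>)"
    using int by (subst integral_minus[symmetric]) (intro integral_mono, auto)
  moreover have "c * (measure (pos_part \<mu>) UNIV + measure (neg_part \<mu>) UNIV) \<le> c"
    using tv c mult_left_mono[of "tv \<mu> UNIV" 1 c]
    by (simp add: measure_pos_part[OF \<mu>] measure_neg_part[OF \<mu>] field_simps)
  ultimately have "integral\<^sup>L (pos_part \<mu>) ?d + integral\<^sup>L (neg_part \<mu>) ?d \<le> 0"
    using attain int by (simp add: signed_integral_def algebra_simps)
  moreover have "0 \<le> integral\<^sup>L (pos_part \<mu>) ?d" "0 \<le> integral\<^sup>L (neg_part \<mu>) ?d"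
    using g by (auto intro!: integral_nonneg_AE)
  ultimately have "integral\<^sup>L (pos_part \<mu>) ?d = 0" "integral\<^sup>L (neg_part \<mu>) ?d = 0" by linarith+
  then have "AE x in pos_part \<mu>. ?d x = 0" "AE x in neg_part \<mu>. ?d x = 0"
    using integrable_parts[OF \<mu> d] g(2)
    by (auto simp: integral_nonneg_eq_0_iff_AE)
  moreover have N: "?N \<in> sets borel" using g(1) by measurable
  moreover have "?N = {x. ?d x \<noteq> 0}" by auto
  ultimately have "emeasure (pos_part \<mu>) ?N = 0" "emeasure (neg_part \<mu>) ?N = 0"
    using AE_iff_measurable[of ?N "pos_part \<mu>" "\<lambda>x. ?d x = 0"]
      AE_iff_measurable[of ?N "neg_part \<mu>" "\<lambda>x. ?d x = 0"] by simp_all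
  then have "measure (pos_part \<mu>) ?N = 0" "measure (neg_part \<mu>) ?N = 0"
    by (simp_all add: measure_def)
  then show ?thesis
    using N by (simp add: measure_pos_part[OF \<mu>] measure_neg_part[OF \<mu>])
qed

section \<open>Finite combinations of point masses\<close>

text \<open>
  The value 0 outside the Borel sets is the normalisation that \<^const>\<open>signed_borel_measure\<close> requires.
\<close>

definition point_masses :: "'b set \<Rightarrow> ('b \<Rightarrow> real) \<Rightarrow> 'b::topological_space set \<Rightarrow> real" where
  "point_masses F a A = (if A \<in> sets borel then \<Sum>p\<in>F \<inter> A. a p else 0)"

lemma signed_borel_measure_point_masses:
  assumes "finite F"
  shows "signed_borel_measure (point_masses F a)"
  unfolding signed_borel_measure_def
proof (intro conjI allI impI)
  fix A :: "nat \<Rightarrow> 'a set"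
  assume A: "range A \<subseteq> sets borel" "disjoint_family A"
  have eq: "point_masses F a B = (\<Sum>p\<in>F. a p * indicator B p)" if "B \<in> sets borel" for B
    using that assms by (simp add: point_masses_def indicator_def sum.inter_restrict if_distrib cong: if_cong)
  have "(\<lambda>i. \<Sum>p\<in>F. a p * indicator (A i) p) sums (\<Sum>p\<in>F. a p * indicator (\<Union>i. A i) p)"
    using A(2) by (intro sums_sum sums_mult indicator_sums) (auto simp: disjoint_family_on_def)
  moreover have "A i \<in> sets borel" for i using A(1) by blast
  ultimately show "(\<lambda>i. point_masses F a (A i)) sums point_masses F a (\<Union>i. A i)"
    by (simp add: eq)
qed (simp add: point_masses_def)

lemma variation_point_masses:
  fixes F :: "'b::t1_space set"
  assumes F: "finite F" and A: "A \<in> sets borel"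
  shows "variation (point_masses F a) A = ennreal (\<Sum>p\<in>F \<inter> A. \<bar>a p\<bar>)"
proof (rule antisym)
  let ?\<mu> = "point_masses F a"
  have \<mu>: "signed_borel_measure ?\<mu>" using F by (rule signed_borel_measure_point_masses)
  have split: "(\<Sum>p\<in>F \<inter> A. f p) = (\<Sum>p\<in>F \<inter> D. f p) + (\<Sum>p\<in>F \<inter> (A - D). f p)"
    if "D \<subseteq> A" for D and f :: "'b \<Rightarrow> real"
    using F that by (subst sum.union_disjoint[symmetric]) (auto intro!: sum.cong)
  show "variation ?\<mu> A \<le> ennreal (\<Sum>p\<in>F \<inter> A. \<bar>a p\<bar>)"
    unfolding variation_def
  proof (rule SUP_least, clarify)
    fix P :: "'b set set" assume "finite P" "P \<subseteq> sets borel" "partition_on A P"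
    then obtain D where D: "D \<in> sets borel" "D \<subseteq> A"
      and eq: "(\<Sum>B\<in>P. ennreal \<bar>?\<mu> B\<bar>) = ennreal (?\<mu> D - ?\<mu> (A - D))"
      using partition_split[OF \<mu>] by blast
    have "?\<mu> D - ?\<mu> (A - D) \<le> \<bar>\<Sum>p\<in>F \<inter> D. a p\<bar> + \<bar>\<Sum>p\<in>F \<inter> (A - D). a p\<bar>"
      using D A by (simp add: point_masses_def)
    also have "\<dots> \<le> (\<Sum>p\<in>F \<inter> A. \<bar>a p\<bar>)"
      unfolding split[OF D(2)] by (intro add_mono sum_abs)
    finally show "(\<Sum>B\<in>P. ennreal \<bar>?\<mu> B\<bar>) \<le> ennreal (\<Sum>p\<in>F \<inter> A. \<bar>a p\<bar>)"
      unfolding eq by (rule ennreal_leI)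
  qed
  let ?D = "{p \<in> F \<inter> A. 0 \<le> a p}"
  have D: "?D \<in> sets borel" using F by (intro borel_closed finite_imp_closed) auto
  have "(\<Sum>p\<in>F \<inter> A. \<bar>a p\<bar>) = (\<Sum>p\<in>F \<inter> ?D. a p) + (\<Sum>p\<in>F \<inter> (A - ?D). - a p)"
    by (subst split[of ?D]) (auto intro!: arg_cong2[where f = "(+)"] sum.cong)
  also have "\<dots> \<le> \<bar>?\<mu> ?D\<bar> + \<bar>?\<mu> (A - ?D)\<bar>"
    using A D by (simp add: point_masses_def sum_negf)
  finally have "ennreal (\<Sum>p\<in>F \<inter> A. \<bar>a p\<bar>) \<le> ennreal (\<bar>?\<mu> ?D\<bar> + \<bar>?\<mu> (A - ?D)\<bar>)"
    by (rule ennreal_leI)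
  also have "\<dots> \<le> variation ?\<mu> A"
    using A D by (intro split_le_variation[OF \<mu>]) auto
  finally show "ennreal (\<Sum>p\<in>F \<inter> A. \<bar>a p\<bar>) \<le> variation ?\<mu> A" .
qed

text \<open>
  The variation of a set \<open>A\<close> depends only on \<open>F \<inter> A\<close>, which is also the trace on \<open>F\<close> of a compact
  subset of \<open>A\<close> and of an open superset.
\<close>

lemma point_masses_regular:
  fixes F :: "'b::t2_space set"
  assumes F: "finite F"
  shows "point_masses F a \<in> regular_measures"
proof -
  let ?\<mu> = "point_masses F a"
  have \<mu>: "signed_borel_measure ?\<mu>" using F by (rule signed_borel_measure_point_masses)
  have "regular_signed_measure ?\<mu>"
    unfolding regular_signed_measure_def
  proof (intro ballI conjI)
    fix A :: "'b set" assume A: "A \<in> sets borel"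
    have U: "open (- (F - A))" using F by (intro open_Compl finite_imp_closed) auto
    have C: "compact (F \<inter> A)" using F by (intro finite_imp_compact) auto
    have eq: "variation ?\<mu> B = variation ?\<mu> A" if "B \<in> sets borel" "F \<inter> B = F \<inter> A" for B
      using that A by (simp add: variation_point_masses[OF F])
    show "variation ?\<mu> A = (INF U \<in> {U. open U \<and> A \<subseteq> U}. variation ?\<mu> U)"
    proof (rule antisym)
      show "variation ?\<mu> A \<le> (INF U \<in> {U. open U \<and> A \<subseteq> U}. variation ?\<mu> U)"
        using A by (intro INF_greatest variation_mono) auto
      have "(INF U \<in> {U. open U \<and> A \<subseteq> U}. variation ?\<mu> U) \<le> variation ?\<mu> (- (F - A))"
        using U by (intro INF_lower) auto
      then show "(INF U \<in> {U. open U \<and> A \<subseteq> U}. variation ?\<mu> U) \<le> variation ?\<mu> A"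
        using eq[OF borel_open[OF U]] by (simp add: Int_Un_distrib)
    qed
    show "variation ?\<mu> A = (SUP C \<in> {C. compact C \<and> C \<subseteq> A}. variation ?\<mu> C)"
    proof (rule antisym)
      show "(SUP C \<in> {C. compact C \<and> C \<subseteq> A}. variation ?\<mu> C) \<le> variation ?\<mu> A"
        using A by (intro SUP_least variation_mono) (auto intro: borel_compact)
      have "variation ?\<mu> (F \<inter> A) \<le> (SUP C \<in> {C. compact C \<and> C \<subseteq> A}. variation ?\<mu> C)"
        using C by (intro SUP_upper) auto
      then show "variation ?\<mu> A \<le> (SUP C \<in> {C. compact C \<and> C \<subseteq> A}. variation ?\<mu> C)"
        using eq[of "F \<inter> A"] borel_compact[OF C] by auto
    qed
  qed
  with \<mu> show ?thesis by (simp add: regular_measures_def)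
qed

lemma signed_integral_point_masses:
  fixes F :: "'b::t1_space set"
  assumes F: "finite F" and g: "g \<in> borel_measurable borel"
  shows "signed_integral (point_masses F a) g = (\<Sum>p\<in>F. a p * g p)"
proof -
  have "- F \<in> sets borel" using finite_imp_closed[OF F] by auto
  then have "tv (point_masses F a) (- F) = 0"
    using variation_point_masses[OF F, of "- F" a] by simp
  then have "signed_integral (point_masses F a) g = (\<Sum>p\<in>F. g p * point_masses F a {p})"
    by (intro signed_integral_finitely_supported signed_borel_measure_point_masses F g)
  then show ?thesis by (simp add: point_masses_def mult.commute)
qed

lemma tv_norm_point_masses:
  fixes F :: "'b::t1_space set"
  assumes "finite F"
  shows "tv_norm (point_masses F a) = (\<Sum>p\<in>F. \<bar>a p\<bar>)"
  by (simp add: tv_norm_def variation_point_masses[OF assms] sum_nonneg)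

section \<open>Continuous functions vanishing at infinity\<close>

lemma C0_measurable: "f \<in> C0 \<Longrightarrow> f \<in> borel_measurable borel"
  by (simp add: C0_def borel_measurable_continuous_onI)

lemma C0_compact: "f \<in> C0 \<Longrightarrow> 0 < \<epsilon> \<Longrightarrow> compact {x. \<epsilon> \<le> \<bar>f x\<bar>}"
  by (simp add: C0_def)

lemma C0_bounded:
  assumes f: "f \<in> C0"
  obtains c where "\<And>x. \<bar>f x\<bar> \<le> c"
proof -
  have "compact (f ` {x. 1 \<le> \<bar>f x\<bar>})"
    using f by (intro compact_continuous_image) (auto simp: C0_def intro: continuous_on_subset)
  then have "bounded (f ` {x. 1 \<le> \<bar>f x\<bar>})" by (rule compact_imp_bounded)
  then obtain c where c: "\<And>x. 1 \<le> \<bar>f x\<bar> \<Longrightarrow> \<bar>f x\<bar> \<le> c"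
    by (auto simp: bounded_iff)
  have "\<bar>f x\<bar> \<le> max 1 c" for x
    using c[of x] by (cases "1 \<le> \<bar>f x\<bar>") auto
  then show ?thesis by (rule that)
qed

lemma abs_le_sup_norm:
  assumes "f \<in> C0"
  shows "\<bar>f x\<bar> \<le> sup_norm f"
proof -
  obtain c where "\<And>x. \<bar>f x\<bar> \<le> c" using C0_bounded[OF assms] by blast
  then have "bdd_above (range (\<lambda>x. \<bar>f x\<bar>))" by (auto simp: bdd_above_def)
  then show ?thesis unfolding sup_norm_def by (rule cSUP_upper[rotated]) simp
qed

lemma sup_norm_le: "(\<And>x. \<bar>f x\<bar> \<le> c) \<Longrightarrow> sup_norm f \<le> c"
  unfolding sup_norm_def by (intro cSUP_least) auto

lemma sup_norm_nonneg: "f \<in> C0 \<Longrightarrow> 0 \<le> sup_norm f"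
  using abs_le_sup_norm abs_ge_zero order_trans by blast

lemma sup_norm_pos:
  assumes f: "f \<in> C0" "f \<noteq> 0"
  shows "0 < sup_norm f"
proof -
  obtain x where "f x \<noteq> 0" using f(2) by (auto simp: fun_eq_iff)
  then show ?thesis using abs_le_sup_norm[OF f(1), of x] by linarith
qed

lemma C0_add_scale:
  fixes f g :: "'b::topological_space \<Rightarrow> real"
  assumes f: "f \<in> C0" and g: "g \<in> C0"
  shows "f + r *\<^sub>R g \<in> C0"
  unfolding C0_def
proof (intro CollectI conjI allI impI)
  have cont: "continuous_on UNIV f" "continuous_on UNIV g" using f g by (auto simp: C0_def)
  have fun_eq: "f + r *\<^sub>R g = (\<lambda>x. f x + r * g x)" by (auto simp: fun_eq_iff)
  show cont_sum: "continuous_on UNIV (f + r *\<^sub>R g)"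
    unfolding fun_eq by (intro continuous_intros cont)
  fix \<epsilon> :: real assume \<epsilon>: "0 < \<epsilon>"
  \<comment> \<open>The summand 1 keeps the threshold for \<open>g\<close> positive when \<open>r = 0\<close>.\<close>
  let ?\<delta> = "\<epsilon> / (2 * (\<bar>r\<bar> + 1))"
  let ?K = "{x. \<epsilon> / 2 \<le> \<bar>f x\<bar>} \<union> {x. ?\<delta> \<le> \<bar>g x\<bar>}"
  have "0 < \<epsilon> / 2" "0 < ?\<delta>" using \<epsilon> by simp_all
  then have K: "compact ?K" by (intro compact_Un C0_compact f g)
  have "closed {x. \<epsilon> \<le> \<bar>(f + r *\<^sub>R g) x\<bar>}"
    by (intro closed_Collect_le continuous_intros cont_sum)
  moreover have "{x. \<epsilon> \<le> \<bar>(f + r *\<^sub>R g) x\<bar>} \<subseteq> ?K"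
  proof
    fix x assume x: "x \<in> {x. \<epsilon> \<le> \<bar>(f + r *\<^sub>R g) x\<bar>}"
    show "x \<in> ?K"
    proof (rule ccontr)
      assume "x \<notin> ?K"
      then have less: "\<bar>f x\<bar> < \<epsilon> / 2" "\<bar>g x\<bar> < ?\<delta>" by auto
      have "\<bar>r * g x\<bar> \<le> (\<bar>r\<bar> + 1) * \<bar>g x\<bar>" by (simp add: abs_mult mult_right_mono)
      also have "\<dots> < (\<bar>r\<bar> + 1) * ?\<delta>" using less(2) by (intro mult_strict_left_mono) auto
      also have "\<dots> = \<epsilon> / 2" by (simp add: field_simps)
      finally show False using x less(1) by auto
    qed
  qed
  ultimately show "compact {x. \<epsilon> \<le> \<bar>(f + r *\<^sub>R g) x\<bar>}"
    using K compact_Int_closed[of ?K] by (metis (no_types, lifting) inf.absorb2)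
qed

lemma C0_zero: "0 \<in> C0"
  by (auto simp: C0_def zero_fun_def)

lemma subspace_C0: "subspace (C0 :: ('b::topological_space \<Rightarrow> real) set)"
  unfolding subspace_def
proof (intro conjI ballI allI)
  show "(0 :: 'b \<Rightarrow> real) \<in> C0" by (rule C0_zero)
  show "f + g \<in> C0" if "f \<in> C0" "g \<in> C0" for f g :: "'b \<Rightarrow> real"
    using C0_add_scale[OF that, of 1] by simp
  show "r *\<^sub>R f \<in> C0" if "f \<in> C0" for r and f :: "'b \<Rightarrow> real"
    using C0_add_scale[OF C0_zero that] by simp
qed

text \<open>
  Urysohn's lemma in the form needed for measures. The bump function is cut off inside a relatively
  compact neighbourhood of \<open>C\<close>, which makes it vanish at infinity.
\<close>

lemma C0_bump:
  fixes C U :: "'b::t2_space set"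
  assumes loc_compact: "locally_compact_space (euclidean :: 'b topology)"
    and C: "compact C" and U: "open U" "C \<subseteq> U"
  obtains h where "h \<in> C0" "\<And>x. indicator C x \<le> h x" "\<And>x. h x \<le> (indicator U x :: real)"
proof -
  have haus: "Hausdorff_space (euclidean :: 'b topology)"
    by (simp add: Hausdorff_space_def disjnt_def separation_t2)
  then have "\<exists>V L. openin (euclidean :: 'b topology) V \<and> compactin euclidean L \<and>
      closedin euclidean L \<and> C \<subseteq> V \<and> V \<subseteq> L"
    using loc_compact C locally_compact_space_compact_closed_compact[of "euclidean :: 'b topology"]
    by simp
  then obtain V L where V: "open V" "C \<subseteq> V" "V \<subseteq> L" and L: "compact L" by auto
  have creg: "completely_regular_space (euclidean :: 'b topology)"
    using loc_compact haus by (simp add: locally_compact_regular_imp_completely_regular_space)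
  obtain h :: "'b \<Rightarrow> real" where h: "continuous_map euclidean (subtopology euclidean {0..1}) h"
      "h ` (- (U \<inter> V)) \<subseteq> {0}" "h ` C \<subseteq> {1}"
  proof (rule Urysohn_completely_regular_compact_closed[of "0::real" 1 "euclidean :: 'b topology" C "- (U \<inter> V)"])
    show "closedin euclidean (- (U \<inter> V))" using U V by (auto intro: closed_Compl)
    show "disjnt C (- (U \<inter> V))" using U V by (auto simp: disjnt_def)
  qed (use creg C in auto)
  have cont: "continuous_on UNIV h" and range: "\<And>x. h x \<in> {0..1}"
    using h(1) by (auto simp: continuous_map_in_subtopology)
  have zero: "h x = 0" if "x \<notin> U \<or> x \<notin> V" for x using h(2) that by auto
  have one: "h x = 1" if "x \<in> C" for x using h(3) that by auto
  show ?thesis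
  proof
    have "compact {x. \<epsilon> \<le> \<bar>h x\<bar>}" if \<epsilon>: "0 < \<epsilon>" for \<epsilon>
    proof -
      have "closed {x. \<epsilon> \<le> \<bar>h x\<bar>}" by (intro closed_Collect_le continuous_intros cont)
      moreover have "{x. \<epsilon> \<le> \<bar>h x\<bar>} \<subseteq> L" using zero V \<epsilon> by force
      ultimately show ?thesis using L compact_Int_closed[of L] by (metis inf.absorb2)
    qed
    then show "h \<in> C0" using cont by (simp add: C0_def)
    show "indicator C x \<le> h x" for x
      using one[of x] range[of x] by (auto simp: indicator_def)
    show "h x \<le> indicator U x" for x
      using zero[of x] range[of x] by (auto simp: indicator_def)
  qed
qed

section \<open>Regular measures as functionals\<close>

lemma regular_measures_signed: "\<mu> \<in> regular_measures \<Longrightarrow> signed_borel_measure \<mu>"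
  by (simp add: regular_measures_def)

lemma regular_outer:
  assumes \<mu>: "\<mu> \<in> regular_measures" and A: "A \<in> sets borel" and \<epsilon>: "0 < \<epsilon>"
  obtains U where "open U" "A \<subseteq> U" "tv \<mu> (U - A) < \<epsilon>"
proof -
  have s: "signed_borel_measure \<mu>" using \<mu> by (rule regular_measures_signed)
  have "(INF U \<in> {U. open U \<and> A \<subseteq> U}. variation \<mu> U) = variation \<mu> A"
    using \<mu> A by (simp add: regular_measures_def regular_signed_measure_def)
  also have "\<dots> = ennreal (tv \<mu> A)" by (rule ennreal_tv[OF s, symmetric])
  also have "\<dots> < ennreal (tv \<mu> A + \<epsilon>)" using \<epsilon> by (simp add: ennreal_less_iff)
  finally obtain U where U: "open U" "A \<subseteq> U" "variation \<mu> U < ennreal (tv \<mu> A + \<epsilon>)"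
    by (auto simp: INF_less_iff)
  then have "tv \<mu> U < tv \<mu> A + \<epsilon>"
    by (subst (asm) ennreal_tv[OF s, symmetric]) (simp add: ennreal_less_iff)
  then have "tv \<mu> (U - A) < \<epsilon>" using U A by (subst tv_Diff[OF s]) auto
  with U show ?thesis by (intro that) auto
qed

lemma regular_inner:
  fixes \<mu> :: "'b::t2_space set \<Rightarrow> real"
  assumes \<mu>: "\<mu> \<in> regular_measures" and A: "A \<in> sets borel" and \<epsilon>: "0 < \<epsilon>"
  obtains C where "compact C" "C \<subseteq> A" "tv \<mu> (A - C) < \<epsilon>"
proof (cases "tv \<mu> A < \<epsilon>")
  case True
  then show ?thesis by (intro that[of "{}"]) auto
next
  case False
  have s: "signed_borel_measure \<mu>" using \<mu> by (rule regular_measures_signed)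
  have "ennreal (tv \<mu> A - \<epsilon>) < ennreal (tv \<mu> A)"
    using \<epsilon> False by (simp add: ennreal_less_iff)
  also have "\<dots> = variation \<mu> A" by (rule ennreal_tv[OF s])
  also have "\<dots> = (SUP C \<in> {C. compact C \<and> C \<subseteq> A}. variation \<mu> C)"
    using \<mu> A unfolding regular_measures_def regular_signed_measure_def by blast
  finally obtain C where C: "compact C" "C \<subseteq> A" "ennreal (tv \<mu> A - \<epsilon>) < variation \<mu> C"
    by (auto simp: less_SUP_iff)
  then have "tv \<mu> A - \<epsilon> < tv \<mu> C"
    using False by (subst (asm) ennreal_tv[OF s, symmetric]) (simp add: ennreal_less_iff)
  then have "tv \<mu> (A - C) < \<epsilon>"
    using C A by (subst tv_Diff[OF s]) (auto intro: borel_compact)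
  with C show ?thesis by (intro that) auto
qed

lemma signed_integral_C0_add_scale:
  assumes "signed_borel_measure \<mu>" "f \<in> C0" "g \<in> C0"
  shows "signed_integral \<mu> (f + r *\<^sub>R g) = signed_integral \<mu> f + r * signed_integral \<mu> g"
proof -
  have "f + r *\<^sub>R g = (\<lambda>x. f x + r * g x)" by (auto simp: fun_eq_iff)
  then show ?thesis
    using signed_integral_add_scale[OF assms(1) C0_measurable[OF assms(2)] abs_le_sup_norm[OF assms(2)]
      C0_measurable[OF assms(3)] abs_le_sup_norm[OF assms(3)], of r] by simp
qed

lemma signed_integral_C0_diff:
  assumes "signed_borel_measure \<mu>" "f \<in> C0" "g \<in> C0"
  shows "signed_integral \<mu> (f - g) = signed_integral \<mu> f - signed_integral \<mu> g"
  using signed_integral_C0_add_scale[OF assms, of "-1"] by simp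

lemma signed_integral_zero: "signed_integral \<mu> 0 = 0"
  by (simp add: signed_integral_def zero_fun_def)

lemma signed_integral_eq_on_span:
  assumes \<mu>: "signed_borel_measure \<mu>" and \<nu>: "signed_borel_measure \<nu>"
    and S: "S \<subseteq> C0" and eq: "\<And>f. f \<in> S \<Longrightarrow> signed_integral \<mu> f = signed_integral \<nu> f"
    and f: "f \<in> span S"
  shows "signed_integral \<mu> f = signed_integral \<nu> f"
proof -
  have "f \<in> C0 \<and> signed_integral \<mu> f = signed_integral \<nu> f"
    using f
  proof (induction rule: span_induct_alt)
    case base
    show ?case using C0_zero signed_integral_zero by metis
  next
    case (step r s f)
    then have "s \<in> C0" "signed_integral \<mu> s = signed_integral \<nu> s" using S eq by auto
    with step show ?case
      using C0_add_scale[of f s r] signed_integral_C0_add_scale[OF \<mu>, of f s r]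
        signed_integral_C0_add_scale[OF \<nu>, of f s r] by (metis add.commute)
  qed
  then show ?thesis by simp
qed

lemma signed_integral_eq_on_dense:
  assumes \<mu>: "signed_borel_measure \<mu>" and \<nu>: "signed_borel_measure \<nu>"
    and D: "D \<subseteq> C0" and eq: "\<And>h. h \<in> D \<Longrightarrow> signed_integral \<mu> h = signed_integral \<nu> h"
    and dense: "\<And>\<epsilon>. 0 < \<epsilon> \<Longrightarrow> \<exists>h\<in>D. sup_norm (f - h) < \<epsilon>" and f: "f \<in> C0"
  shows "signed_integral \<mu> f = signed_integral \<nu> f"
proof (rule ccontr)
  let ?t = "tv \<mu> UNIV + tv \<nu> UNIV + 1" and ?d = "\<bar>signed_integral \<mu> f - signed_integral \<nu> f\<bar>"
  assume "signed_integral \<mu> f \<noteq> signed_integral \<nu> f"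
  moreover have t: "0 < ?t" by (simp add: add_nonneg_pos)
  ultimately have pos: "0 < ?d / ?t" by simp
  then obtain h where h: "h \<in> D" "sup_norm (f - h) < ?d / ?t" using dense by blast
  have hC: "h \<in> C0" using h D by auto
  have fh: "f - h \<in> C0" using C0_add_scale[OF f hC, of "-1"] by simp
  note bound = signed_integral_bound[OF _ C0_measurable[OF fh] abs_le_sup_norm[OF fh]]
  have "?d \<le> sup_norm (f - h) * tv \<mu> UNIV + sup_norm (f - h) * tv \<nu> UNIV"
    using bound[OF \<mu>] bound[OF \<nu>] eq[OF h(1)]
    unfolding signed_integral_C0_diff[OF \<mu> f hC] signed_integral_C0_diff[OF \<nu> f hC] by linarith
  also have "\<dots> \<le> sup_norm (f - h) * ?t"
    using sup_norm_nonneg[OF fh] by (simp add: algebra_simps)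
  also have "\<dots> < ?d / ?t * ?t"
    using h(2) t by (intro mult_strict_right_mono)
  finally show False using t by simp
qed

text \<open>
  On a compact set two regular measures with the same integrals agree, because bump functions supported
  in a small neighbourhood integrate to almost the measure of the set; inner regularity then extends the
  equality to all Borel sets.
\<close>

lemma regular_measure_unique:
  fixes \<mu> \<nu> :: "'b::t2_space set \<Rightarrow> real"
  assumes loc_compact: "locally_compact_space (euclidean :: 'b topology)"
    and \<mu>: "\<mu> \<in> regular_measures" and \<nu>: "\<nu> \<in> regular_measures"
    and eq: "\<And>f. f \<in> C0 \<Longrightarrow> signed_integral \<mu> f = signed_integral \<nu> f"
  shows "\<mu> = \<nu>"
proof
  fix A :: "'b set"
  note s = regular_measures_signed[OF \<mu>] regular_measures_signed[OF \<nu>]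
  have compact_eq: "\<mu> C = \<nu> C" if C: "compact C" for C
  proof (rule ccontr)
    assume "\<mu> C \<noteq> \<nu> C"
    then have \<epsilon>: "0 < \<bar>\<mu> C - \<nu> C\<bar> / 2" (is "0 < ?\<epsilon>") by simp
    note Cb = borel_compact[OF C]
    obtain U where U: "open U" "C \<subseteq> U" "tv \<mu> (U - C) < ?\<epsilon>" using regular_outer[OF \<mu> Cb \<epsilon>] .
    obtain W where W: "open W" "C \<subseteq> W" "tv \<nu> (W - C) < ?\<epsilon>" using regular_outer[OF \<nu> Cb \<epsilon>] .
    have UW: "open (U \<inter> W)" "C \<subseteq> U \<inter> W" using U W by auto
    obtain h where h: "h \<in> C0" "\<And>x. indicator C x \<le> h x" "\<And>x. h x \<le> (indicator (U \<inter> W) x :: real)"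
      using C0_bump[OF loc_compact C UW] by blast
    note near = signed_integral_near_indicator[OF _ C0_measurable[OF h(1)] h(2,3) Cb borel_open[OF UW(1)] UW(2)]
    have "tv \<mu> (U \<inter> W - C) \<le> tv \<mu> (U - C)" "tv \<nu> (U \<inter> W - C) \<le> tv \<nu> (W - C)"
      using U W Cb by (auto intro!: tv_mono s)
    then have "\<bar>signed_integral \<mu> h - \<mu> C\<bar> < ?\<epsilon>" "\<bar>signed_integral \<mu> h - \<nu> C\<bar> < ?\<epsilon>"
      using near[OF s(1)] near[OF s(2)] eq[OF h(1)] U(3) W(3) by simp_all
    then have "\<bar>\<mu> C - \<nu> C\<bar> < \<bar>\<mu> C - \<nu> C\<bar>"
      unfolding dist_real_def[symmetric] by (rule dist_triangle_half_r)
    then show False by simp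
  qed
  show "\<mu> A = \<nu> A"
  proof (cases "A \<in> sets borel")
    case False
    then show ?thesis using s by (simp add: signed_borel_measure_def)
  next
    case A: True
    show ?thesis
    proof (rule ccontr)
      assume "\<mu> A \<noteq> \<nu> A"
      then have \<epsilon>: "0 < \<bar>\<mu> A - \<nu> A\<bar> / 2" (is "0 < ?\<epsilon>") by simp
      obtain C where C: "compact C" "C \<subseteq> A" "tv \<mu> (A - C) < ?\<epsilon>" using regular_inner[OF \<mu> A \<epsilon>] .
      obtain D where D: "compact D" "D \<subseteq> A" "tv \<nu> (A - D) < ?\<epsilon>" using regular_inner[OF \<nu> A \<epsilon>] .
      have CD: "compact (C \<union> D)" "C \<union> D \<subseteq> A" using C D by auto
      note b = borel_compact[OF CD(1)] borel_compact[OF C(1)] borel_compact[OF D(1)]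
      have "\<bar>\<mu> (A - (C \<union> D))\<bar> \<le> tv \<mu> (A - (C \<union> D))" "tv \<mu> (A - (C \<union> D)) \<le> tv \<mu> (A - C)"
        using A b by (auto intro!: abs_le_tv tv_mono s)
      then have \<mu>_small: "\<bar>\<mu> (A - (C \<union> D))\<bar> < ?\<epsilon>" using C(3) by (meson le_less_trans)
      have "\<bar>\<nu> (A - (C \<union> D))\<bar> \<le> tv \<nu> (A - (C \<union> D))" "tv \<nu> (A - (C \<union> D)) \<le> tv \<nu> (A - D)"
        using A b by (auto intro!: abs_le_tv tv_mono s)
      then have \<nu>_small: "\<bar>\<nu> (A - (C \<union> D))\<bar> < ?\<epsilon>" using D(3) by (meson le_less_trans)
      have "\<mu> (A - (C \<union> D)) = \<mu> A - \<mu> (C \<union> D)" "\<nu> (A - (C \<union> D)) = \<nu> A - \<nu> (C \<union> D)"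
        using A b CD by (auto intro!: signed_borel_measure_Diff s)
      then have "\<bar>\<mu> A - \<nu> A\<bar> = \<bar>\<mu> (A - (C \<union> D)) - \<nu> (A - (C \<union> D))\<bar>"
        using compact_eq[OF CD(1)] by simp
      also have "\<dots> \<le> \<bar>\<mu> (A - (C \<union> D))\<bar> + \<bar>\<nu> (A - (C \<union> D))\<bar>" by (rule abs_triangle_ineq4)
      also have "\<dots> < ?\<epsilon> + ?\<epsilon>" using \<mu>_small \<nu>_small by (rule add_strict_mono)
      finally show False by simp
    qed
  qed
qed

text \<open>
  This is the half of the Riesz duality that bounds the total variation by the norm of the functional.
  A two-set splitting that nearly exhausts the variation is approximated from inside by compact sets
  \<open>C\<close> and \<open>D\<close>. The difference of a bump function for \<open>C\<close> and one for \<open>D\<close> takes values in \<open>[-1, 1]\<close>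
  even if their supports overlap.
\<close>

lemma tv_le_functional_norm:
  fixes \<mu> :: "'b::t2_space set \<Rightarrow> real"
  assumes loc_compact: "locally_compact_space (euclidean :: 'b topology)"
    and \<mu>: "\<mu> \<in> regular_measures"
    and le: "\<And>h. h \<in> C0 \<Longrightarrow> (\<And>x. \<bar>h x\<bar> \<le> 1) \<Longrightarrow> signed_integral \<mu> h \<le> c"
  shows "tv \<mu> UNIV \<le> c"
proof (rule field_le_epsilon)
  fix e :: real assume "0 < e"
  then have e: "0 < e / 4" by simp
  note s = regular_measures_signed[OF \<mu>]
  have approx: "\<exists>C h. C \<subseteq> A \<and> h \<in> C0 \<and> (\<forall>x. 0 \<le> h x \<and> h x \<le> 1) \<and> \<bar>signed_integral \<mu> h - \<mu> A\<bar> < e / 2"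
    if A: "A \<in> sets borel" for A
  proof -
    obtain C where C: "compact C" "C \<subseteq> A" "tv \<mu> (A - C) < e / 4" using regular_inner[OF \<mu> A e] .
    note Cb = borel_compact[OF C(1)]
    obtain U where U: "open U" "C \<subseteq> U" "tv \<mu> (U - C) < e / 4" using regular_outer[OF \<mu> Cb e] .
    obtain h where h: "h \<in> C0" "\<And>x. indicator C x \<le> h x" "\<And>x. h x \<le> (indicator U x :: real)"
      using C0_bump[OF loc_compact C(1) U(1,2)] by blast
    have "\<bar>signed_integral \<mu> h - \<mu> C\<bar> \<le> tv \<mu> (U - C)"
      using signed_integral_near_indicator[OF s C0_measurable[OF h(1)] h(2,3) Cb borel_open[OF U(1)] U(2)] .
    moreover have "\<bar>\<mu> (A - C)\<bar> \<le> tv \<mu> (A - C)" using A Cb by (intro abs_le_tv s) auto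
    moreover have "\<mu> (A - C) = \<mu> A - \<mu> C" using A Cb C by (intro signed_borel_measure_Diff s)
    ultimately have "\<bar>signed_integral \<mu> h - \<mu> A\<bar> < e / 2" using C(3) U(3) by linarith
    moreover have "0 \<le> h x" for x by (rule order_trans[OF indicator_pos_le h(2)])
    moreover have "h x \<le> 1" for x by (rule order_trans[OF h(3) indicator_le_1])
    ultimately show ?thesis using C(2) h(1) by blast
  qed
  have "variation \<mu> UNIV \<le> ennreal (c + e)"
    unfolding variation_def
  proof (rule SUP_least, clarify)
    fix P :: "'b set set" assume "finite P" "P \<subseteq> sets borel" "partition_on UNIV P"
    then obtain D where D: "D \<in> sets borel" "D \<subseteq> UNIV"
      and split: "(\<Sum>B\<in>P. ennreal \<bar>\<mu> B\<bar>) = ennreal (\<mu> D - \<mu> (UNIV - D))"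
      by (rule partition_split[OF s])
    obtain h where h: "h \<in> C0" "\<And>x. 0 \<le> h x \<and> h x \<le> 1" "\<bar>signed_integral \<mu> h - \<mu> D\<bar> < e / 2"
      using approx[OF D(1)] by blast
    have "UNIV - D \<in> sets borel" using D(1) by auto
    then obtain k where k: "k \<in> C0" "\<And>x. 0 \<le> k x \<and> k x \<le> 1"
        "\<bar>signed_integral \<mu> k - \<mu> (UNIV - D)\<bar> < e / 2"
      using approx by blast
    have "\<bar>(h - k) x\<bar> \<le> 1" for x using h(2)[of x] k(2)[of x] by (auto simp: abs_le_iff)
    moreover have "h - k \<in> C0" using C0_add_scale[OF h(1) k(1), of "-1"] by simp
    ultimately have "signed_integral \<mu> (h - k) \<le> c" by (intro le)
    then have "signed_integral \<mu> h - signed_integral \<mu> k \<le> c"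
      by (simp add: signed_integral_C0_diff[OF s h(1) k(1)])
    then have "\<mu> D - \<mu> (UNIV - D) \<le> c + e" using h(3) k(3) by linarith
    then show "(\<Sum>B\<in>P. ennreal \<bar>\<mu> B\<bar>) \<le> ennreal (c + e)" unfolding split by (rule ennreal_leI)
  qed
  moreover have "0 \<le> c" using le[OF C0_zero] by (simp add: signed_integral_zero)
  ultimately show "tv \<mu> UNIV \<le> c + e"
    using \<open>0 < e\<close> by (intro enn2real_leI) auto
qed

section \<open>The reproducing kernel Banach space\<close>

text \<open>
  Injectivity of \<open>\<mu> \<mapsto> f\<^sub>\<mu>\<close>: the values of \<open>f\<^sub>\<mu>\<close> are the integrals of a family of functions whose span is
  dense, hence they determine the functional that \<open>\<mu>\<close> induces on \<^const>\<open>C0\<close>.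
\<close>

lemma rkbs_measure_eq:
  fixes K :: "'a \<Rightarrow> 'b::t2_space \<Rightarrow> real"
  assumes loc_compact: "locally_compact_space (euclidean :: 'b topology)"
    and K_C0: "\<And>y. K y \<in> C0"
    and K_dense: "\<And>f \<epsilon>. f \<in> C0 \<Longrightarrow> \<epsilon> > 0 \<Longrightarrow> \<exists>h \<in> span (range K). sup_norm (f - h) < \<epsilon>"
    and \<mu>: "\<mu> \<in> regular_measures"
  shows "rkbs_measure K (rkbs_fun K \<mu>) = \<mu>"
  unfolding rkbs_measure_def
proof (rule the_equality)
  fix \<nu> :: "'b set \<Rightarrow> real"
  assume \<nu>: "\<nu> \<in> regular_measures \<and> rkbs_fun K \<nu> = rkbs_fun K \<mu>"
  note s = regular_measures_signed[OF conjunct1[OF \<nu>]] regular_measures_signed[OF \<mu>]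
  have K_eq: "signed_integral \<nu> f = signed_integral \<mu> f" if "f \<in> range K" for f
    using \<nu> that by (auto simp: rkbs_fun_def fun_eq_iff)
  have range: "range K \<subseteq> C0" using K_C0 by auto
  then have span: "span (range K) \<subseteq> C0" by (intro span_minimal subspace_C0)
  have "signed_integral \<nu> f = signed_integral \<mu> f" if f: "f \<in> C0" for f
    using signed_integral_eq_on_dense[OF s span signed_integral_eq_on_span[OF s range K_eq] K_dense[OF f] f] .
  then show "\<nu> = \<mu>" using regular_measure_unique[OF loc_compact conjunct1[OF \<nu>] \<mu>] by blast
qed (use \<mu> in simp)

lemma rkbs_fun_point_masses:
  fixes K :: "'a \<Rightarrow> 'b::t1_space \<Rightarrow> real"
  assumes "\<And>y. K y \<in> C0" "finite F"
  shows "rkbs_fun K (point_masses F a) = (\<lambda>y. \<Sum>p\<in>F. a p * K y p)"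
  using assms by (simp add: rkbs_fun_def signed_integral_point_masses C0_measurable)

lemma rkbs_norm_kernel_combination:
  fixes K :: "'a \<Rightarrow> 'b::t2_space \<Rightarrow> real"
  assumes loc_compact: "locally_compact_space (euclidean :: 'b topology)"
    and K_C0: "\<And>y. K y \<in> C0"
    and K_dense: "\<And>f \<epsilon>. f \<in> C0 \<Longrightarrow> \<epsilon> > 0 \<Longrightarrow> \<exists>h \<in> span (range K). sup_norm (f - h) < \<epsilon>"
    and F: "finite F"
  shows "rkbs_norm K (\<lambda>y. \<Sum>p\<in>F. a p * K y p) = (\<Sum>p\<in>F. \<bar>a p\<bar>)"
  using rkbs_measure_eq[of K, OF loc_compact K_C0 K_dense point_masses_regular[OF F, of a]]
  by (simp add: rkbs_norm_def rkbs_fun_point_masses[of K, OF K_C0 F] tv_norm_point_masses[OF F])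

text \<open>
  A subgradient \<open>f\<^sub>\<mu>\<close> at \<open>g\<close> attains the norm of \<open>g\<close>, as the tests \<open>2 g\<close> and \<open>0\<close> show, and hence
  has dual norm at most 1.
\<close>

lemma sup_norm_subdiffD:
  fixes K :: "'a \<Rightarrow> 'b::t2_space \<Rightarrow> real"
  assumes loc_compact: "locally_compact_space (euclidean :: 'b topology)"
    and K_C0: "\<And>y. K y \<in> C0"
    and K_dense: "\<And>f \<epsilon>. f \<in> C0 \<Longrightarrow> \<epsilon> > 0 \<Longrightarrow> \<exists>h \<in> span (range K). sup_norm (f - h) < \<epsilon>"
    and g: "g \<in> C0" and f: "f \<in> sup_norm_subdiff K g"
  obtains \<mu> where "\<mu> \<in> regular_measures" "f = rkbs_fun K \<mu>"
    "signed_integral \<mu> g = sup_norm g" "tv \<mu> UNIV \<le> 1"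
proof -
  obtain \<mu> where \<mu>: "\<mu> \<in> regular_measures" and f_eq: "f = rkbs_fun K \<mu>"
    using f by (auto simp: sup_norm_subdiff_def rkbs_def)
  note s = regular_measures_signed[OF \<mu>]
  have "rkbs_measure K f = \<mu>"
    unfolding f_eq by (rule rkbs_measure_eq[OF loc_compact K_C0 K_dense \<mu>])
  then have sub: "signed_integral \<mu> h - signed_integral \<mu> g \<le> sup_norm h - sup_norm g" if "h \<in> C0" for h
    using f that by (auto simp: sup_norm_subdiff_def rkbs_pairing_def
      signed_integral_C0_diff[OF s that g, symmetric])
  have norm_0: "sup_norm (0 :: 'b \<Rightarrow> real) = 0"
    by (simp add: sup_norm_def zero_fun_def)
  have double: "g + 1 *\<^sub>R g \<in> C0" by (rule C0_add_scale[OF g g])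
  have "sup_norm (g + 1 *\<^sub>R g) \<le> 2 * sup_norm g"
    using abs_le_sup_norm[OF g] by (intro sup_norm_le) (simp add: abs_mult)
  then have "signed_integral \<mu> g \<le> sup_norm g"
    using sub[OF double] signed_integral_C0_add_scale[OF s g g, of 1] by simp
  moreover have "sup_norm g \<le> signed_integral \<mu> g"
    using sub[OF C0_zero] norm_0 signed_integral_zero[of \<mu>] by linarith
  ultimately have attain: "signed_integral \<mu> g = sup_norm g" by simp
  have "signed_integral \<mu> h \<le> 1" if "h \<in> C0" "\<And>x. \<bar>h x\<bar> \<le> 1" for h
    using sub[OF that(1)] attain sup_norm_le[of h 1, OF that(2)] by linarith
  then have "tv \<mu> UNIV \<le> 1" by (rule tv_le_functional_norm[OF loc_compact \<mu>])
  with \<mu> f_eq attain show ?thesis by (rule that)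
qed

text \<open>
  At a norming point \<open>p\<close>, the functional \<open>h \<mapsto> sgn (g p) h p\<close> is bounded by the sup norm and equals it
  at \<open>g\<close>; the same holds for every average of such functionals.
\<close>

lemma sgn_combination_in_subdiff:
  fixes K :: "'a \<Rightarrow> 'b::t2_space \<Rightarrow> real"
  assumes loc_compact: "locally_compact_space (euclidean :: 'b topology)"
    and K_C0: "\<And>y. K y \<in> C0"
    and K_dense: "\<And>f \<epsilon>. f \<in> C0 \<Longrightarrow> \<epsilon> > 0 \<Longrightarrow> \<exists>h \<in> span (range K). sup_norm (f - h) < \<epsilon>"
    and g: "g \<in> C0" and F: "finite F" "F \<subseteq> norming_set g"
    and u: "\<And>p. p \<in> F \<Longrightarrow> 0 \<le> u p" "sum u F = 1"
  shows "(\<lambda>y. \<Sum>p\<in>F. u p * (sgn (g p) * K y p)) \<in> sup_norm_subdiff K g"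
proof -
  let ?\<mu> = "point_masses F (\<lambda>p. u p * sgn (g p))"
  have \<mu>: "?\<mu> \<in> regular_measures" using F(1) by (rule point_masses_regular)
  have f_eq: "(\<lambda>y. \<Sum>p\<in>F. u p * (sgn (g p) * K y p)) = rkbs_fun K ?\<mu>"
    by (simp add: rkbs_fun_point_masses[of K, OF K_C0 F(1)] mult.assoc)
  have "signed_integral ?\<mu> (h - g) \<le> sup_norm h - sup_norm g" if h: "h \<in> C0" for h
  proof -
    have hg: "h - g \<in> C0" using C0_add_scale[OF h g, of "-1"] by simp
    have "signed_integral ?\<mu> (h - g) = (\<Sum>p\<in>F. u p * sgn (g p) * (h - g) p)"
      by (rule signed_integral_point_masses[OF F(1) C0_measurable[OF hg]])
    also have "\<dots> \<le> (\<Sum>p\<in>F. u p * (sup_norm h - sup_norm g))"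
    proof (rule sum_mono)
      fix p assume p: "p \<in> F"
      have "sgn (g p) * h p \<le> sup_norm h"
        using abs_le_sup_norm[OF h, of p] by (auto simp: sgn_if abs_le_iff)
      moreover have "sgn (g p) * g p = sup_norm g"
        using F(2) p by (auto simp: norming_set_def abs_sgn mult.commute)
      ultimately have "sgn (g p) * (h - g) p \<le> sup_norm h - sup_norm g"
        by (simp add: right_diff_distrib)
      then show "u p * sgn (g p) * (h - g) p \<le> u p * (sup_norm h - sup_norm g)"
        using u(1)[OF p] by (simp add: mult.assoc mult_left_mono)
    qed
    also have "\<dots> = sup_norm h - sup_norm g"
      using u(2) by (simp add: sum_distrib_right[symmetric])
    finally show ?thesis .
  qed
  then show ?thesis
    unfolding f_eq using \<mu> rkbs_measure_eq[of K, OF loc_compact K_C0 K_dense \<mu>]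
    by (auto simp: sup_norm_subdiff_def rkbs_def rkbs_pairing_def)
qed

text \<open>
  The measure of a subgradient lives on the norming set, where its integral against \<open>g\<close> is at most
  \<open>sup_norm g\<close> times its total variation. Since that bound is attained, every point of the norming set
  attains it, which fixes the sign of the mass there and makes the absolute masses sum to 1.
\<close>

lemma subgradient_eq_sgn_combination:
  fixes K :: "'a \<Rightarrow> 'b::t2_space \<Rightarrow> real"
  assumes loc_compact: "locally_compact_space (euclidean :: 'b topology)"
    and K_C0: "\<And>y. K y \<in> C0"
    and K_dense: "\<And>f \<epsilon>. f \<in> C0 \<Longrightarrow> \<epsilon> > 0 \<Longrightarrow> \<exists>h \<in> span (range K). sup_norm (f - h) < \<epsilon>"
    and g: "g \<in> C0" "g \<noteq> 0" and fin: "finite (norming_set g)"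
    and f: "f \<in> sup_norm_subdiff K g"
  obtains u where "\<And>p. p \<in> norming_set g \<Longrightarrow> 0 \<le> u p" "sum u (norming_set g) = 1"
    "f = (\<lambda>y. \<Sum>p\<in>norming_set g. u p * (sgn (g p) * K y p))"
proof -
  let ?N = "norming_set g" and ?c = "sup_norm g"
  obtain \<mu> where \<mu>: "\<mu> \<in> regular_measures" and f_eq: "f = rkbs_fun K \<mu>"
    and attain: "signed_integral \<mu> g = ?c" and tv: "tv \<mu> UNIV \<le> 1"
    using sup_norm_subdiffD[OF loc_compact K_C0 K_dense g(1) f] .
  note s = regular_measures_signed[OF \<mu>]
  have c: "0 < ?c" by (rule sup_norm_pos[OF g])
  have "- ?N = {x. \<bar>g x\<bar> \<noteq> ?c}" by (auto simp: norming_set_def)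
  then have conc: "tv \<mu> (- ?N) = 0"
    using norming_measure_concentrated[OF s tv C0_measurable[OF g(1)] abs_le_sup_norm[OF g(1)]] attain
    by simp
  note int = signed_integral_finitely_supported[OF s fin conc]
  have mass: "(\<Sum>p\<in>?N. \<bar>\<mu> {p}\<bar>) \<le> 1"
  proof -
    have N: "?N \<in> sets borel" using finite_imp_closed[OF fin] by auto
    have "(\<Sum>B\<in>(\<lambda>p. {p}) ` ?N. ennreal \<bar>\<mu> B\<bar>) \<le> variation \<mu> ?N"
      using fin by (intro sum_le_variation partition_on_singletons) auto
    also have "\<dots> \<le> variation \<mu> UNIV" using N by (intro variation_mono) auto
    also have "\<dots> = ennreal (tv \<mu> UNIV)" by (rule ennreal_tv[OF s, symmetric])
    also have "\<dots> \<le> ennreal 1" using tv by (rule ennreal_leI)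
    finally show ?thesis by (subst (asm) sum.reindex) (auto simp: sum_nonneg)
  qed
  have norming: "\<bar>g p\<bar> = ?c" if "p \<in> ?N" for p using that by (simp add: norming_set_def)
  have le: "g p * \<mu> {p} \<le> ?c * \<bar>\<mu> {p}\<bar>" if "p \<in> ?N" for p
    using norming[OF that] abs_ge_self[of "g p * \<mu> {p}"] by (simp add: abs_mult)
  have "(\<Sum>p\<in>?N. g p * \<mu> {p}) = ?c"
    using int[OF C0_measurable[OF g(1)]] attain by simp
  moreover have "(\<Sum>p\<in>?N. g p * \<mu> {p}) \<le> ?c * (\<Sum>p\<in>?N. \<bar>\<mu> {p}\<bar>)"
    using le by (simp add: sum_distrib_left sum_mono)
  moreover have "?c * (\<Sum>p\<in>?N. \<bar>\<mu> {p}\<bar>) \<le> ?c * 1" using mass c by (intro mult_left_mono) auto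
  ultimately have eq: "?c * (\<Sum>p\<in>?N. \<bar>\<mu> {p}\<bar>) = ?c"
    and sum0: "(\<Sum>p\<in>?N. ?c * \<bar>\<mu> {p}\<bar> - g p * \<mu> {p}) = 0"
    by (simp_all add: sum_subtractf sum_distrib_left[symmetric])
  have "?c * \<bar>\<mu> {p}\<bar> = g p * \<mu> {p}" if "p \<in> ?N" for p
    using sum0 le fin that by (subst (asm) sum_nonneg_eq_0_iff) auto
  then have sign: "\<mu> {p} = \<bar>\<mu> {p}\<bar> * sgn (g p)" if "p \<in> ?N" for p
  proof -
    have "\<bar>g p\<bar> * \<bar>\<mu> {p}\<bar> = g p * \<mu> {p}" using norming that \<open>\<And>p. p \<in> ?N \<Longrightarrow> ?c * \<bar>\<mu> {p}\<bar> = g p * \<mu> {p}\<close> by simp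
    moreover have "g p \<noteq> 0" using norming[OF that] c by auto
    ultimately show ?thesis
      by (auto simp: sgn_if abs_if mult_less_0_iff zero_less_mult_iff split: if_splits)
  qed
  show ?thesis
  proof
    show "(\<Sum>p\<in>?N. \<bar>\<mu> {p}\<bar>) = 1" using eq c by simp
    show "f = (\<lambda>y. \<Sum>p\<in>?N. \<bar>\<mu> {p}\<bar> * (sgn (g p) * K y p))"
    proof
      fix y
      have "f y = (\<Sum>p\<in>?N. K y p * \<mu> {p})"
        using int[OF C0_measurable[OF K_C0]] by (simp add: f_eq rkbs_fun_def)
      also have "\<dots> = (\<Sum>p\<in>?N. \<bar>\<mu> {p}\<bar> * (sgn (g p) * K y p))"
        by (intro sum.cong refl) (subst sign, auto simp: mult_ac)
      finally show "f y = (\<Sum>p\<in>?N. \<bar>\<mu> {p}\<bar> * (sgn (g p) * K y p))" .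
    qed
  qed simp
qed

text \<open>
  The subdifferential is the convex hull of the finitely many signed kernel functions at norming
  points, and an extreme point of a convex hull belongs to the generating set.
\<close>

lemma extreme_subgradient:
  fixes K :: "'a \<Rightarrow> 'b::t2_space \<Rightarrow> real"
  assumes loc_compact: "locally_compact_space (euclidean :: 'b topology)"
    and K_C0: "\<And>y. K y \<in> C0"
    and K_dense: "\<And>f \<epsilon>. f \<in> C0 \<Longrightarrow> \<epsilon> > 0 \<Longrightarrow> \<exists>h \<in> span (range K). sup_norm (f - h) < \<epsilon>"
    and g: "g \<in> C0" "g \<noteq> 0" and fin: "finite (norming_set g)"
    and f: "f extreme_point_of sup_norm_subdiff K g"
  obtains p where "p \<in> norming_set g" "f = (\<lambda>y. K y p) \<or> f = - (\<lambda>y. K y p)"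
proof -
  let ?N = "norming_set g" and ?k = "\<lambda>p y. sgn (g p) * K y p"
  have comb: "(\<Sum>p\<in>F. u p *\<^sub>R ?k p) = (\<lambda>y. \<Sum>p\<in>F. u p * (sgn (g p) * K y p))" for u F
    by (rule ext) (induction rule: infinite_finite_induct, auto)
  have subset: "convex hull (?k ` ?N) \<subseteq> sup_norm_subdiff K g"
  proof
    fix e assume e: "e \<in> convex hull (?k ` ?N)"
    \<comment> \<open>The weights in a convex hull are attached to functions; choosing one norming point for each
      function turns them into weights on points.\<close>
    obtain F where F: "F \<subseteq> ?N" "inj_on ?k F" "?k ` ?N = ?k ` F"
      using subset_image_inj[of "?k ` ?N" ?k ?N] by auto
    then have fin_F: "finite F" using fin finite_subset by blast
    obtain w where w: "\<forall>v\<in>?k ` F. 0 \<le> w v" "sum w (?k ` F) = 1"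
      and e_eq: "e = (\<Sum>v\<in>?k ` F. w v *\<^sub>R v)"
      using e fin_F unfolding F(3) by (auto simp: convex_hull_finite)
    have "e = (\<lambda>y. \<Sum>p\<in>F. w (?k p) * (sgn (g p) * K y p))"
      unfolding e_eq comb[symmetric] by (simp add: sum.reindex[OF F(2)] o_def)
    moreover have "(\<Sum>p\<in>F. w (?k p)) = 1"
      using w(2) by (simp add: sum.reindex[OF F(2)] o_def)
    ultimately show "e \<in> sup_norm_subdiff K g"
      using sgn_combination_in_subdiff[of K g F "\<lambda>p. w (?k p)", OF loc_compact K_C0 K_dense g(1) fin_F F(1)] w(1)
      by blast
  qed
  have "f \<in> sup_norm_subdiff K g" using f by (simp add: extreme_point_of_def)
  then obtain u where u: "\<And>p. p \<in> ?N \<Longrightarrow> 0 \<le> u p" "sum u ?N = 1"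
    and "f = (\<lambda>y. \<Sum>p\<in>?N. u p * (sgn (g p) * K y p))"
    using subgradient_eq_sgn_combination[of K, OF loc_compact K_C0 K_dense g fin] by blast
  then have "f = (\<Sum>p\<in>?N. u p *\<^sub>R ?k p)" by (simp only: comb)
  also have "\<dots> \<in> convex hull (?k ` ?N)"
    using u fin by (intro convex_sum convex_convex_hull) (auto intro: hull_inc)
  finally have "f extreme_point_of (convex hull (?k ` ?N))"
    using f subset by (auto simp: extreme_point_of_def)
  then have "f \<in> ?k ` ?N" by (rule extreme_point_of_convex_hull)
  then obtain p where p: "p \<in> ?N" "f = ?k p" by auto
  have "g p \<noteq> 0" using p(1) sup_norm_pos[OF g] by (auto simp: norming_set_def)
  then have "f = (\<lambda>y. K y p) \<or> f = - (\<lambda>y. K y p)"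
    using p(2) by (auto simp: sgn_if fun_eq_iff)
  with p(1) show ?thesis by (rule that)
qed

theorem lemma27:
  fixes K :: "'a \<Rightarrow> 'b::t2_space \<Rightarrow> real"
    and x :: "nat \<Rightarrow> 'a" and n :: nat
    and V :: "('b \<Rightarrow> real) set"
  assumes loc_compact: "locally_compact_space (euclidean :: 'b topology)"
    and K_C0: "\<And>y. K y \<in> C0"
    and K_dense: "\<And>f \<epsilon>. f \<in> C0 \<Longrightarrow> \<epsilon> > 0 \<Longrightarrow> \<exists>h \<in> span (range K). sup_norm (f - h) < \<epsilon>"
    and x_distinct: "inj_on x {1..n}"
    and K_inj: "inj_on (\<lambda>j. K (x j)) {1..n}"
    and K_indep: "independent ((\<lambda>j. K (x j)) ` {1..n})"
    and V_def: "V = span ((\<lambda>j. K (x j)) ` {1..n})"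
    and V_finite: "\<And>g. g \<in> V \<Longrightarrow> g \<noteq> 0 \<Longrightarrow> finite (norming_set g)"
  shows "(\<forall>g\<in>V. g \<noteq> 0 \<longrightarrow>
            finite (norming_set g) \<and>
            {f. f extreme_point_of sup_norm_subdiff K g}
              \<subseteq> {- (\<lambda>y. K y x') | x'. x' \<in> norming_set g} \<union> {(\<lambda>y. K y x') | x'. x' \<in> norming_set g}) \<and>
         (\<forall>m (x' :: nat \<Rightarrow> 'b) (\<alpha> :: nat \<Rightarrow> real).
            inj_on x' {1..m} \<longrightarrow>
            rkbs_norm K (\<lambda>y. \<Sum>j=1..m. \<alpha> j * K y (x' j)) = (\<Sum>j=1..m. \<bar>\<alpha> j\<bar>))"
proof (intro conjI ballI allI impI)
  fix g assume g: "g \<in> V" "g \<noteq> 0"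
  show fin: "finite (norming_set g)" using V_finite[OF g] .
  have "V \<subseteq> C0" unfolding V_def using K_C0 by (intro span_minimal subspace_C0) auto
  then have gC: "g \<in> C0" using g(1) by auto
  show "{f. f extreme_point_of sup_norm_subdiff K g}
      \<subseteq> {- (\<lambda>y. K y x') | x'. x' \<in> norming_set g} \<union> {(\<lambda>y. K y x') | x'. x' \<in> norming_set g}"
  proof
    fix f assume "f \<in> {f. f extreme_point_of sup_norm_subdiff K g}"
    then have "f extreme_point_of sup_norm_subdiff K g" by simp
    then obtain p where "p \<in> norming_set g" "f = (\<lambda>y. K y p) \<or> f = - (\<lambda>y. K y p)"
      using extreme_subgradient[of K g f, OF loc_compact K_C0 K_dense gC g(2) fin] by blast
    then show "f \<in> {- (\<lambda>y. K y x') | x'. x' \<in> norming_set g} \<union> {(\<lambda>y. K y x') | x'. x' \<in> norming_set g}"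
      by blast
  qed
next
  fix m and x' :: "nat \<Rightarrow> 'b" and \<alpha> :: "nat \<Rightarrow> real"
  assume inj: "inj_on x' {1..m}"
  \<comment> \<open>The coefficients are indexed by positions; as the points are distinct they can be attached to
    the points themselves.\<close>
  let ?a = "\<lambda>p. \<alpha> (the_inv_into {1..m} x' p)"
  have "(\<Sum>p\<in>x' ` {1..m}. ?a p * K y p) = (\<Sum>j=1..m. \<alpha> j * K y (x' j))" for y
    using inj by (simp add: sum.reindex the_inv_into_f_f)
  moreover have "(\<Sum>p\<in>x' ` {1..m}. \<bar>?a p\<bar>) = (\<Sum>j=1..m. \<bar>\<alpha> j\<bar>)"
    using inj by (simp add: sum.reindex the_inv_into_f_f)
  ultimately show "rkbs_norm K (\<lambda>y. \<Sum>j=1..m. \<alpha> j * K y (x' j)) = (\<Sum>j=1..m. \<bar>\<alpha> j\<bar>)"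
    using rkbs_norm_kernel_combination[of K, OF loc_compact K_C0 K_dense, of "x' ` {1..m}" ?a]
    by simp
qed

end
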